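(* There is a point of $\omega^\ast$ which is a weak P-point of $\omega^\ast$ but is not a $\mu$-point of $\omega^\ast$.
   Context: $\omega^\ast=\beta\omega\setminus\omega=\mathrm{St}(\mathcal{P}(\omega)/\mathrm{fin})$ is the remainder of the Stone-Čech compactification of $\omega$, i.e. the space of non-principal ultrafilters on $\omega$. A measure on a topological space $X$ is a $\sigma$-additive Radon probability measure on the Borel sets of $X$. It is non-atomic if $\mu(\{x\})=0$ for every $x\in X$. The support of $\mu$ is $\mathrm{supp}(\mu)=\bigcap\{C\subseteq X: C \text{ closed},\ \mu(C)=1\}$. A point $x\in X$ is a $\mu$-point if it avoids non-atomic measures, i.e. $x\notin\mathrm{supp}(\nu)$ for every non-atomic measure $\nu$ on $X$. A point $p\in X$ is a weak P-point if $p\notin\overline{C}$ for every countable $C\subseteq X\setminus\{p\}$. *)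

theory Defs
  imports "HOL-Analysis.Analysis"
begin

definition ultrafilter :: "'a filter \<Rightarrow> bool" where
  "ultrafilter F \<longleftrightarrow>
     F \<noteq> bot \<and> (\<forall>P. eventually P F \<or> eventually (\<lambda>x. \<not> P x) F)"

text \<open>The Stone topology on the set of all ultrafilters on \<open>\<omega>\<close>; its points are
  filters in the sense of the library type, and the sets of the filter \<open>F\<close> are
  those \<open>A\<close> with \<open>eventually (\<lambda>n. n \<in> A) F\<close>.\<close>

definition beta_omega :: "nat filter topology" where
  "beta_omega =
     topology_generated_by (range (\<lambda>A. {F. ultrafilter F \<and> eventually (\<lambda>n. n \<in> A) F}))"

text \<open>\<open>n \<in> \<omega>\<close> is identified with the principal ultrafilter \<open>principal {n}\<close>.\<close>

definition omega_star :: "nat filter topology" where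
  "omega_star = subtopology beta_omega (- range (\<lambda>n. principal {n}))"

lemma topspace_omega_star:
  "topspace omega_star = {F. ultrafilter F \<and> (\<forall>n. F \<noteq> principal {n})}"
proof -
  have "topspace beta_omega = {F. ultrafilter F}"
    unfolding beta_omega_def topology_generated_by_topspace
    by (auto intro!: exI[of _ UNIV])
  then show ?thesis
    by (auto simp: omega_star_def)
qed

text \<open>The library's \<open>borel\<close> is tied to the class \<open>topological_space\<close>; the Borel sets of an
  abstract topology are generated here by \<open>sigma\<close>. Countable additivity is built into the type of
  measures; the Radon property is inner regularity with respect to compact sets. The condition
  \<open>K \<in> sets M\<close> is automatic in Hausdorff spaces.\<close>

definition radon_prob_measure :: "'a topology \<Rightarrow> 'a measure \<Rightarrow> bool" where
  "radon_prob_measure X M \<longleftrightarrow>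
     space M = topspace X \<and>
     sets M = sets (sigma (topspace X) {U. openin X U}) \<and>
     emeasure M (space M) = 1 \<and>
     (\<forall>B\<in>sets M. emeasure M B =
        (SUP K\<in>{K. compactin X K \<and> K \<in> sets M \<and> K \<subseteq> B}. emeasure M K))"

definition nonatomic :: "'a measure \<Rightarrow> bool" where
  "nonatomic M \<longleftrightarrow> (\<forall>x\<in>space M. emeasure M {x} = 0)"

definition measure_support :: "'a topology \<Rightarrow> 'a measure \<Rightarrow> 'a set" where
  "measure_support X M = \<Inter>{C. closedin X C \<and> emeasure M C = 1}"

definition mu_point :: "'a topology \<Rightarrow> 'a \<Rightarrow> bool" where
  "mu_point X x \<longleftrightarrow> x \<in> topspace X \<and>
     (\<forall>M. radon_prob_measure X M \<and> nonatomic M \<longrightarrow> x \<notin> measure_support X M)"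

definition weak_P_point :: "'a topology \<Rightarrow> 'a \<Rightarrow> bool" where
  "weak_P_point X p \<longleftrightarrow> p \<in> topspace X \<and>
     (\<forall>C. countable C \<and> C \<subseteq> topspace X - {p} \<longrightarrow> p \<notin> X closure_of C)"

end

theory Submission
  imports Defs
begin

text \<open>
  Replace \<open>\<omega>\<close> by the countable set of pairs \<open>x = (n, H)\<close> with
  \<open>H : P(n) \<rightarrow> 2^n\<close>, and let \<open>\<mu>\<close> be the limit along a nonprincipal ultrafilter of the normalised
  counting measures on the finite levels. Every \<open>k \<subseteq> \<omega>\<close> gives a function \<open>x \<mapsto> H(k \<inter> n)\<close>,
  and distinct \<open>k\<close> give functions that are independent on high levels; reducing modulo \<open>2^j\<close>
  gives for each \<open>k\<close> a sequence of partitions into \<open>2^j\<close> pieces of measure at most \<open>2^-j\<close>.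

  Given a decreasing sequence \<open>U\<close> and a choice \<open>i\<close> of one piece from each partition of \<open>k\<close>, let
  \<open>V(U,k,i)\<close> be the set of \<open>x\<close> that lie in \<open>U j\<close> whenever they lie in the chosen \<open>j\<close>-th piece.
  If an ultrafilter \<open>p\<close> contains, for each decreasing sequence \<open>U\<close> from \<open>p\<close>, all \<open>V(U,k,i)\<close>
  for some \<open>k\<close>, then \<open>p\<close> is a weak P-point: for \<open>d 0, d 1, \<dots>\<close> different from \<open>p\<close> choose
  \<open>U j \<in> p - d j\<close> and let \<open>i j\<close> be the piece that belongs to \<open>d j\<close>; no \<open>d j\<close> contains \<open>V(U,k,i)\<close>.

  On \<open>U N\<close>, finitely many sets \<open>V(U,k,i)\<close> can only fail at pieces with index beyond \<open>N\<close>, whose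
  total measure is small. A Kunen-style recursion over all \<open>2^\<omega>\<close> sequences, which uses
  up finitely many of the indices \<open>k\<close> at each stage, therefore keeps all sets of \<open>p\<close> of positive
  \<open>\<mu>\<close>-measure. So \<open>p\<close> lies in the support of the Radon extension of \<open>\<mu>\<close>,
  which is non-atomic because of the small pieces.
\<close>

section \<open>Ultrafilters\<close>

text \<open>Finer filters are smaller, so Zorn's lemma is used for \<open>\<ge>\<close>. A minimal
  proper filter \<open>m\<close> decides every \<open>P\<close>: unless it contains the complement
  of \<open>P\<close>, its restriction to \<open>P\<close> is proper and hence equal to
  \<open>m\<close>.\<close>

lemma ultrafilter_refines:
  assumes "F \<noteq> bot"
  obtains G where "G \<le> F" "ultrafilter G"
proof -
  let ?A = "{G. G \<noteq> bot \<and> G \<le> F}"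
  have "\<exists>m\<in>?A. \<forall>a\<in>?A. m \<ge> a \<longrightarrow> a = m"
  proof (rule predicate_Zorn)
    show "partial_order_on ?A (relation_of (\<ge>) ?A)"
      by (rule partial_order_on_relation_ofI) auto
  next
    fix C assume C: "C \<in> Chains (relation_of (\<ge>) ?A)"
    then have sub: "C \<subseteq> ?A" by (auto simp: Chains_def relation_of_def)
    have lin: "G \<le> H \<or> H \<le> G" if "G \<in> C" "H \<in> C" for G H
      using C that by (auto simp: Chains_def relation_of_def)
    show "\<exists>u\<in>?A. \<forall>a\<in>C. u \<le> a"
    proof (cases "C = {}")
      case True
      then show ?thesis using assms by auto
    next
      case False
      \<comment> \<open>Membership in the infimum of a chain is witnessed by one member, and all
        members are proper.\<close>
      have "\<not> eventually (\<lambda>_. False) (Inf C)"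
      proof -
        have "\<exists>K\<in>C. K \<le> inf G H" if "G \<in> C" "H \<in> C" for G H
          using lin[OF that] that by (metis inf.absorb1 inf.absorb2 order_refl)
        then have "eventually (\<lambda>_. False) (Inf C) \<longleftrightarrow> (\<exists>G\<in>C. eventually (\<lambda>_. False) G)"
          by (rule eventually_Inf_base[OF False])
        then show ?thesis using sub by (auto simp: trivial_limit_def)
      qed
      moreover have "Inf C \<le> F"
      proof -
        obtain G where "G \<in> C" using False by blast
        then show ?thesis using sub by (blast intro: order_trans[OF Inf_lower])
      qed
      ultimately show ?thesis
        by (intro bexI[of _ "Inf C"]) (auto simp: trivial_limit_def Inf_lower)
    qed
  qed
  then obtain m where m: "m \<noteq> bot" "m \<le> F"
    and max: "\<And>a. a \<noteq> bot \<Longrightarrow> a \<le> F \<Longrightarrow> a \<le> m \<Longrightarrow> a = m"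
    by auto
  have "eventually P m \<or> eventually (\<lambda>x. \<not> P x) m" for P
  proof (rule disjCI)
    assume "\<not> eventually (\<lambda>x. \<not> P x) m"
    then have "inf m (principal {x. P x}) \<noteq> bot"
      by (auto simp: trivial_limit_def eventually_inf_principal)
    then have "inf m (principal {x. P x}) = m"
      using m by (intro max) (auto intro: le_infI1)
    then have "m \<le> principal {x. P x}" by (metis inf_le2)
    then show "eventually P m" by (simp add: le_principal)
  qed
  then show ?thesis using m that by (auto simp: ultrafilter_def)
qed

lemma ultrafilter_FIP:
  assumes "\<And>X. finite X \<Longrightarrow> X \<subseteq> \<A> \<Longrightarrow> \<Inter>X \<noteq> {}"
  obtains F where "ultrafilter F" "\<And>A. A \<in> \<A> \<Longrightarrow> eventually (\<lambda>x. x \<in> A) F"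
proof -
  let ?F = "INF A\<in>\<A>. principal A"
  have "?F \<noteq> bot"
  proof
    assume "?F = bot"
    then have "eventually (\<lambda>_. False) ?F" by simp
    then have "\<exists>X\<subseteq>\<A>. finite X \<and> eventually (\<lambda>_. False) (INF A\<in>X. principal A)"
      by (rule eventually_INF[THEN iffD1])
    then obtain X where X: "X \<subseteq> \<A>" "finite X" "eventually (\<lambda>_. False) (INF A\<in>X. principal A)"
      by blast
    then have "\<Inter>X = {}" by (auto simp: INF_principal_finite eventually_principal)
    with X assms show False by blast
  qed
  then obtain G where G: "G \<le> ?F" "ultrafilter G" by (rule ultrafilter_refines)
  moreover have "eventually (\<lambda>x. x \<in> A) G" if "A \<in> \<A>" for A
    using G(1) INF_lower[OF that, of principal] by (metis le_principal order_trans)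
  ultimately show ?thesis using that by blast
qed

lemma ultrafilter_not_eventually:
  assumes "ultrafilter F"
  shows "eventually (\<lambda>x. \<not> P x) F \<longleftrightarrow> \<not> eventually P F"
  using assms eventually_happens[of "\<lambda>_. False" F] eventually_conj[of P F "\<lambda>x. \<not> P x"]
  by (auto simp: ultrafilter_def)

lemma ultrafilter_neqE:
  assumes "ultrafilter F" "ultrafilter G" "F \<noteq> G"
  obtains A where "eventually (\<lambda>x. x \<in> A) F" "\<not> eventually (\<lambda>x. x \<in> A) G"
proof -
  obtain P where "eventually P F \<noteq> eventually P G"
    using assms(3) by (auto simp: filter_eq_iff)
  then have "(eventually P F \<and> \<not> eventually P G) \<or>
      (eventually (\<lambda>x. \<not> P x) F \<and> \<not> eventually (\<lambda>x. \<not> P x) G)"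
    using assms by (auto simp: ultrafilter_not_eventually)
  then show ?thesis
    using that[of "{x. P x}"] that[of "{x. \<not> P x}"] by auto
qed

lemma ultrafilter_eventually_bex:
  assumes "ultrafilter F" "finite S"
  shows "eventually (\<lambda>x. \<exists>s\<in>S. P s x) F \<longleftrightarrow> (\<exists>s\<in>S. eventually (P s) F)"
proof -
  have "eventually (\<lambda>x. \<exists>s\<in>S. P s x) F \<longleftrightarrow> \<not> eventually (\<lambda>x. \<forall>s\<in>S. \<not> P s x) F"
    using ultrafilter_not_eventually[OF assms(1), of "\<lambda>x. \<exists>s\<in>S. P s x"] by simp
  also have "\<dots> \<longleftrightarrow> (\<exists>s\<in>S. eventually (P s) F)"
    by (simp add: eventually_ball_finite_distrib assms ultrafilter_not_eventually)
  finally show ?thesis .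
qed

text \<open>Compactness gives a cluster point of the image filter; an ultrafilter decides each of
  its neighbourhoods, so the cluster point is a limit.\<close>

lemma ultrafilter_tendsto:
  fixes f :: "'a \<Rightarrow> 'b::topological_space"
  assumes "ultrafilter F" "compact K" "\<And>x. f x \<in> K"
  shows "\<exists>l\<in>K. (f \<longlongrightarrow> l) F"
proof -
  have "filtermap f F \<noteq> bot" using assms(1) by (auto simp: ultrafilter_def filtermap_bot_iff)
  then obtain l where l: "l \<in> K" "inf (nhds l) (filtermap f F) \<noteq> bot"
    using assms(2,3) unfolding compact_filter by (auto simp: eventually_filtermap)
  have "eventually (\<lambda>x. f x \<in> S) F" if "open S" "l \<in> S" for S
  proof (rule ccontr)
    assume "\<not> eventually (\<lambda>x. f x \<in> S) F"
    then have "eventually (\<lambda>y. y \<notin> S) (filtermap f F)"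
      using assms(1) by (simp add: ultrafilter_not_eventually eventually_filtermap)
    moreover have "eventually (\<lambda>y. y \<in> S) (nhds l)" using that by (simp add: eventually_nhds_in_open)
    ultimately have "eventually (\<lambda>_. False) (inf (nhds l) (filtermap f F))"
      unfolding eventually_inf by blast
    with l(2) show False by (simp add: trivial_limit_def)
  qed
  then show ?thesis using l(1) by (auto simp: tendsto_def)
qed

lemma ultrafilter_neq_bot: "ultrafilter F \<Longrightarrow> F \<noteq> bot"
  by (simp add: ultrafilter_def)

lemma le_sequentiallyI:
  assumes "\<And>k. eventually (\<lambda>n. k \<le> n) F"
  shows "F \<le> sequentially"
  using assms unfolding le_filter_def eventually_sequentially by (metis eventually_mono)

text \<open>An ultrafilter containing a singleton is principal; any other one contains the
  complement of every singleton, hence every tail.\<close>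

lemma mem_topspace_omega_star:
  "F \<in> topspace omega_star \<longleftrightarrow> ultrafilter F \<and> F \<le> sequentially"
proof -
  have "(\<forall>n. F \<noteq> principal {n}) \<longleftrightarrow> F \<le> sequentially" if F: "ultrafilter F" for F :: "nat filter"
  proof
    assume np: "\<forall>n. F \<noteq> principal {n}"
    have ne: "eventually (\<lambda>m. m \<noteq> n) F" for n
    proof (rule ccontr)
      assume "\<not> eventually (\<lambda>m. m \<noteq> n) F"
      then have "eventually (\<lambda>m. m = n) F" using F by (auto simp: ultrafilter_def)
      then have "eventually P F \<longleftrightarrow> P n" for P
        using eventually_happens'[of F "\<lambda>m. P m \<and> m = n"] F
        by (auto simp: ultrafilter_def elim: eventually_mono dest: eventually_conj)
      then have "F = principal {n}" by (auto simp: filter_eq_iff eventually_principal)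
      with np show False by blast
    qed
    have "eventually (\<lambda>m. N \<le> m) F" for N
      using eventually_ball_finite[of "{..<N}" "\<lambda>m n. m \<noteq> n" F] ne
      by (auto elim!: eventually_mono simp: not_less[symmetric])
    then show "F \<le> sequentially"
      by (rule le_sequentiallyI)
  next
    assume le: "F \<le> sequentially"
    show "\<forall>n. F \<noteq> principal {n}"
    proof (intro allI notI)
      fix n assume "F = principal {n}"
      moreover have "eventually (\<lambda>m. m > n) F"
        using le by (rule filter_leD) (rule eventually_gt_at_top)
      ultimately show False by (simp add: eventually_principal)
    qed
  qed
  then show ?thesis by (auto simp: topspace_omega_star)
qed

section \<open>Radon measures from finitely additive measures\<close>

definition hat :: "nat set \<Rightarrow> nat filter set" where
  "hat A = {F \<in> topspace omega_star. eventually (\<lambda>n. n \<in> A) F}"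

lemma hat_subset_topspace: "hat A \<subseteq> topspace omega_star"
  by (auto simp: hat_def)

lemma hat_UNIV: "hat UNIV = topspace omega_star"
  by (auto simp: hat_def)

lemma hat_empty: "hat {} = {}"
  by (auto simp: hat_def mem_topspace_omega_star trivial_limit_def dest!: ultrafilter_neq_bot)

lemma hat_Compl: "hat (- A) = topspace omega_star - hat A"
  by (auto simp: hat_def mem_topspace_omega_star ultrafilter_not_eventually)

lemma hat_Int: "hat (A \<inter> B) = hat A \<inter> hat B"
  by (auto simp: hat_def eventually_conj_iff)

lemma hat_UN: "finite I \<Longrightarrow> hat (\<Union>i\<in>I. B i) = (\<Union>i\<in>I. hat (B i))"
  by (auto simp: hat_def mem_topspace_omega_star ultrafilter_eventually_bex)

lemma hat_Un: "hat (A \<union> B) = hat A \<union> hat B"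
  using hat_UN[of "{A, B}" "\<lambda>S. S"] by simp

lemma openin_hat: "openin omega_star (hat A)"
proof -
  have "openin beta_omega {F. ultrafilter F \<and> eventually (\<lambda>n. n \<in> A) F}"
    unfolding beta_omega_def by (rule topology_generated_by_Basis) auto
  moreover have "hat A = {F. ultrafilter F \<and> eventually (\<lambda>n. n \<in> A) F} \<inter> (- range (\<lambda>n. principal {n}))"
    by (auto simp: hat_def topspace_omega_star)
  ultimately show ?thesis
    unfolding omega_star_def by (auto simp: openin_subtopology)
qed

lemma closedin_hat: "closedin omega_star (hat A)"
  using openin_hat[of "- A"] by (simp add: closedin_def hat_subset_topspace hat_Compl)

lemma openin_omega_star_base:
  assumes "openin omega_star G" "F \<in> G"
  shows "\<exists>A. F \<in> hat A \<and> hat A \<subseteq> G"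
proof -
  let ?S = "range (\<lambda>A. {F. ultrafilter F \<and> eventually (\<lambda>n. n \<in> A) F}) :: nat filter set set"
  obtain T where T: "openin beta_omega T" "G = T \<inter> - range (\<lambda>n. principal {n})"
    using assms(1) unfolding omega_star_def by (auto simp: openin_subtopology)
  have F: "F \<in> topspace omega_star" using openin_subset[OF assms(1)] assms(2) by blast
  have "generate_topology_on ?S T"
    using T(1) unfolding beta_omega_def openin_topology_generated_by_iff .
  moreover have "F \<in> T" using T assms(2) by auto
  ultimately have "\<exists>A. F \<in> hat A \<and> hat A \<subseteq> T"
  proof (induction rule: generate_topology_on.induct)
    case (Int a b)
    then obtain A B where "F \<in> hat A" "hat A \<subseteq> a" "F \<in> hat B" "hat B \<subseteq> b" by blast
    then show ?case by (intro exI[of _ "A \<inter> B"]) (auto simp: hat_Int)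
  next
    case (UN K)
    then show ?case by (meson UnionE Union_upper order_trans)
  next
    case (Basis s)
    then obtain A where "s = {F. ultrafilter F \<and> eventually (\<lambda>n. n \<in> A) F}" by auto
    then show ?case using F Basis by (intro exI[of _ A]) (auto simp: hat_def topspace_omega_star)
  qed auto
  then obtain A where "F \<in> hat A" "hat A \<subseteq> T" by auto
  moreover have "hat A \<subseteq> - range (\<lambda>n. principal {n})"
    by (auto simp: hat_def topspace_omega_star)
  ultimately show ?thesis using T(2) by blast
qed

text \<open>Compactness in combinatorial form. If no finite \<open>J\<close> worked,
  \<open>A\<close>, the sets \<open>- B i\<close> and the tails would have the finite intersection
  property. An ultrafilter containing them is nonprincipal because of the tails, so it is a point of
  \<open>hat A\<close> outside the cover.\<close>

lemma hat_subset_UN: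
  assumes "hat A \<subseteq> (\<Union>i\<in>I. hat (B i))"
  obtains J where "finite J" "J \<subseteq> I" "finite (A - (\<Union>i\<in>J. B i))"
proof (rule ccontr)
  assume no: "\<not> thesis"
  note obt = that
  let ?C = "insert A ((\<lambda>i. - B i) ` I \<union> range (\<lambda>n. {n..}))"
  have fip: "\<Inter>X \<noteq> {}" if X: "finite X" "X \<subseteq> ?C" for X
  proof -
    have "finite (X \<inter> (\<lambda>i. - B i) ` I)" "X \<inter> (\<lambda>i. - B i) ` I \<subseteq> (\<lambda>i. - B i) ` I"
      using X by auto
    then obtain J where J: "J \<subseteq> I" "finite J" "X \<inter> (\<lambda>i. - B i) ` I = (\<lambda>i. - B i) ` J"
      by (meson finite_subset_image)
    have "finite (X \<inter> range atLeast)" "X \<inter> range atLeast \<subseteq> range (atLeast :: nat \<Rightarrow> _)"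
      using X by auto
    then obtain N :: "nat set" where N: "finite N" "X \<inter> range atLeast = atLeast ` N"
      by (meson finite_subset_image)
    have "infinite (A - (\<Union>i\<in>J. B i))" using no obt[OF J(2) J(1)] by blast
    \<comment> \<open>An infinite set reaches beyond the finitely many tails in \<open>X\<close>;
      \<open>insert 0\<close> takes care of \<open>N = {}\<close>.\<close>
    then obtain n where n: "n \<in> A - (\<Union>i\<in>J. B i)" "Max (insert 0 N) < n"
      by (meson finite_nat_set_iff_bounded_le not_le)
    have "n \<in> S" if S: "S \<in> X" for S
    proof -
      consider "S = A" | "S \<in> X \<inter> (\<lambda>i. - B i) ` I" | "S \<in> X \<inter> range atLeast"
        using S X(2) by auto
      then show ?thesis
      proof cases
        case 3
        then obtain k where "k \<in> N" "S = {k..}" using N by auto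
        moreover from this have "k \<le> Max (insert 0 N)" using N(1) by auto
        ultimately show ?thesis using n(2) by auto
      qed (use n J in auto)
    qed
    then show ?thesis by auto
  qed
  obtain F where F: "ultrafilter F" "\<And>S. S \<in> ?C \<Longrightarrow> eventually (\<lambda>n. n \<in> S) F"
    by (rule ultrafilter_FIP[of ?C, OF fip]) blast+
  have "eventually (\<lambda>n. n \<in> {k..}) F" for k by (rule F(2)) auto
  then have "F \<le> sequentially" by (intro le_sequentiallyI) simp
  then have "F \<in> hat A" using F by (auto simp: hat_def mem_topspace_omega_star)
  then obtain i where i: "i \<in> I" "eventually (\<lambda>n. n \<in> B i) F" using assms by (auto simp: hat_def)
  moreover have "eventually (\<lambda>n. n \<in> - B i) F" using i by (intro F(2)) auto
  ultimately show False using F(1) by (simp add: ultrafilter_not_eventually)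
qed

text \<open>One direction is compactness for a one-set cover; the other holds since nonprincipal
  ultrafilters ignore finite sets. This identifies the sets \<open>hat A\<close> with the elements
  of P(omega)/fin.\<close>

lemma hat_subset_iff: "hat A \<subseteq> hat B \<longleftrightarrow> finite (A - B)"
proof
  assume "hat A \<subseteq> hat B"
  then have "hat A \<subseteq> (\<Union>i\<in>{B}. hat i)" by simp
  then obtain J where J: "finite J" "J \<subseteq> {B}" "finite (A - (\<Union>i\<in>J. i))"
    by (rule hat_subset_UN)
  show "finite (A - B)" by (rule finite_subset[OF _ J(3)]) (use J(2) in blast)
next
  assume fin: "finite (A - B)"
  have "eventually (\<lambda>n. n \<in> B) F" if "F \<le> sequentially" "eventually (\<lambda>n. n \<in> A) F" for F
  proof -
    obtain k where k: "\<forall>n\<in>A - B. n < k"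
      using fin by (meson finite_nat_set_iff_bounded)
    have "eventually (\<lambda>n. k \<le> n) F" using that(1) eventually_ge_at_top by (rule filter_leD)
    then show ?thesis using that(2)
    proof eventually_elim
      case (elim n)
      then have "\<not> n < k" by simp
      then show ?case using elim k by blast
    qed
  qed
  then show "hat A \<subseteq> hat B" by (auto simp: hat_def mem_topspace_omega_star)
qed

lemma compact_space_omega_star: "compact_space omega_star"
  unfolding compact_space_alt
proof (intro allI impI)
  fix \<U> assume "(\<forall>U\<in>\<U>. openin omega_star U) \<and> topspace omega_star \<subseteq> \<Union>\<U>"
  then have op: "\<forall>U\<in>\<U>. openin omega_star U" and cov: "topspace omega_star \<subseteq> \<Union>\<U>" by auto
  let ?I = "{B. \<exists>U\<in>\<U>. hat B \<subseteq> U}"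
  have "hat UNIV \<subseteq> (\<Union>B\<in>?I. hat B)"
  proof
    fix F assume "F \<in> hat UNIV"
    then obtain U where "U \<in> \<U>" "F \<in> U" using cov by (auto simp: hat_UNIV)
    then show "F \<in> (\<Union>B\<in>?I. hat B)" using op openin_omega_star_base[of U F] by blast
  qed
  then obtain J where J: "finite J" "J \<subseteq> ?I" "finite (UNIV - (\<Union>B\<in>J. B))"
    by (rule hat_subset_UN)
  then have "\<forall>B\<in>J. \<exists>U\<in>\<U>. hat B \<subseteq> U" by auto
  then obtain u where u: "\<And>B. B \<in> J \<Longrightarrow> u B \<in> \<U> \<and> hat B \<subseteq> u B" by metis
  have "topspace omega_star \<subseteq> hat (\<Union>B\<in>J. B)" using J(3) by (simp add: hat_UNIV[symmetric] hat_subset_iff)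
  also have "\<dots> \<subseteq> \<Union>(u ` J)" using u J(1) by (subst hat_UN) auto
  finally have "topspace omega_star \<subseteq> \<Union>(u ` J)" .
  then show "\<exists>\<F>. finite \<F> \<and> \<F> \<subseteq> \<U> \<and> topspace omega_star \<subseteq> \<Union>\<F>"
    using J(1) u by (intro exI[of _ "u ` J"]) auto
qed

text \<open>Vanishing on finite sets makes \<open>m A\<close> depend only on \<open>hat A\<close>;
  values in \<open>ennreal\<close> make nonnegativity automatic.\<close>

locale charge_mod_finite =
  fixes m :: "nat set \<Rightarrow> ennreal"
  assumes m_UNIV: "m UNIV = 1"
    and m_finite: "finite A \<Longrightarrow> m A = 0"
    and m_Un: "A \<inter> B = {} \<Longrightarrow> m (A \<union> B) = m A + m B"
begin

lemma m_mono:
  assumes "finite (A - B)"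
  shows "m A \<le> m B"
proof -
  have "m A = m (A - B) + m (A \<inter> B)" by (subst m_Un[symmetric]) (auto intro: arg_cong[where f = m])
  also have "\<dots> = m (A \<inter> B)" using assms by (simp add: m_finite)
  also have "\<dots> \<le> m (A \<inter> B) + m (B - A)" by simp
  also have "\<dots> = m B" by (subst m_Un[symmetric]) (auto intro: arg_cong[where f = m])
  finally show ?thesis .
qed

lemma m_subadd: "m (A \<union> B) \<le> m A + m B"
proof -
  have "m (A \<union> B) = m A + m (B - A)" by (subst m_Un[symmetric]) (auto intro: arg_cong[where f = m])
  also have "m (B - A) \<le> m B" by (rule m_mono) (simp add: Diff_eq Int_ac)
  finally show ?thesis by (simp add: add_left_mono)
qed

lemma m_UN_lessThan: "m (\<Union>k<n. C k) \<le> (\<Sum>k<n. m (C k))" for n :: nat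
proof (induction n)
  case (Suc n)
  have "m (\<Union>k<Suc n. C k) \<le> m (\<Union>k<n. C k) + m (C n)"
    using m_subadd[of "\<Union>k<n. C k" "C n"] by (simp add: lessThan_Suc Un_commute)
  also have "\<dots> \<le> (\<Sum>k<n. m (C k)) + m (C n)" using Suc by (rule add_right_mono)
  finally show ?case by simp
qed (simp add: m_finite)

section \<open>The outer measure induced by a charge\<close>

definition content :: "nat filter set \<Rightarrow> ennreal" where
  "content G = (SUP A\<in>{A. hat A \<subseteq> G}. m A)"

definition outer :: "nat filter set \<Rightarrow> ennreal" where
  "outer S = (INF G\<in>{G. openin omega_star G \<and> S \<subseteq> G}. content G)"

lemma content_mono: "G \<subseteq> H \<Longrightarrow> content G \<le> content H"
  unfolding content_def by (rule SUP_subset_mono) auto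

lemma le_content: "hat A \<subseteq> G \<Longrightarrow> m A \<le> content G"
  unfolding content_def by (rule SUP_upper) auto

lemma content_hat: "content (hat A) = m A"
  by (rule antisym) (auto simp: content_def hat_subset_iff intro: SUP_least m_mono SUP_upper)

lemma outer_openin: "openin omega_star G \<Longrightarrow> outer G = content G"
  unfolding outer_def by (intro antisym INF_lower INF_greatest) (auto intro: content_mono)

lemma outer_hat: "outer (hat A) = m A"
  by (simp add: outer_openin openin_hat content_hat)

lemma outer_mono: "S \<subseteq> T \<Longrightarrow> outer S \<le> outer T"
  unfolding outer_def by (rule INF_superset_mono) auto

lemma outer_le: "openin omega_star G \<Longrightarrow> S \<subseteq> G \<Longrightarrow> outer S \<le> content G"
  unfolding outer_def by (rule INF_lower) auto

text \<open>A clopen subset of the union is compact, hence covered by finitely many clopen pieces,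
  each inside some \<open>G k\<close>; this leaves only finite subadditivity of
  \<open>m\<close>.\<close>

lemma content_UN_le:
  fixes G :: "nat \<Rightarrow> nat filter set"
  assumes "\<And>k. openin omega_star (G k)"
  shows "content (\<Union>k. G k) \<le> (\<Sum>k. content (G k))"
  unfolding content_def[of "\<Union>k. G k"]
proof (rule SUP_least)
  fix A assume "A \<in> {A. hat A \<subseteq> (\<Union>k. G k)}"
  then have A: "hat A \<subseteq> (\<Union>k. G k)" by simp
  let ?I = "{(k, B). hat B \<subseteq> G k}"
  have "hat A \<subseteq> (\<Union>i\<in>?I. hat (snd i))"
  proof
    fix F assume "F \<in> hat A"
    then obtain k where "F \<in> G k" using A by auto
    then obtain B where "F \<in> hat B" "hat B \<subseteq> G k"
      using openin_omega_star_base[OF assms] by blast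
    then show "F \<in> (\<Union>i\<in>?I. hat (snd i))" by (intro UN_I[of "(k, B)"]) auto
  qed
  then obtain J where J: "finite J" "J \<subseteq> ?I" "finite (A - (\<Union>i\<in>J. snd i))"
    by (rule hat_subset_UN)
  \<comment> \<open>Merging the chosen pieces inside \<open>G k\<close> gives one set per
    \<open>k\<close>, empty from some \<open>n\<close> on.\<close>
  define C where "C k = (\<Union>i\<in>{i \<in> J. fst i = k}. snd i)" for k
  have C: "hat (C k) \<subseteq> G k" for k
  proof -
    have "hat (C k) = (\<Union>i\<in>{i \<in> J. fst i = k}. hat (snd i))"
      unfolding C_def using J(1) by (intro hat_UN) simp
    then show ?thesis using J(2) by fastforce
  qed
  have "finite (fst ` J)" using J(1) by simp
  then obtain n where n: "\<forall>k\<in>fst ` J. k < n" by (meson finite_nat_set_iff_bounded)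
  have "(\<Union>i\<in>J. snd i) \<subseteq> (\<Union>k<n. C k)" using n unfolding C_def by auto
  then have "m A \<le> m (\<Union>k<n. C k)" by (intro m_mono finite_subset[OF _ J(3)]) blast
  also have "\<dots> \<le> (\<Sum>k<n. m (C k))" by (rule m_UN_lessThan)
  also have "\<dots> \<le> (\<Sum>k<n. content (G k))" using C by (intro sum_mono le_content)
  also have "\<dots> \<le> (\<Sum>k. content (G k))" by (intro sum_le_suminf) auto
  finally show "m A \<le> (\<Sum>k. content (G k))" .
qed

lemma outer_measure_space_outer: "outer_measure_space (Pow (topspace omega_star)) outer"
  unfolding outer_measure_space_def
proof (intro conjI)
  have "outer {} = 0"
    using outer_hat[of "{}"] by (simp add: hat_empty m_finite)
  then show "positive (Pow (topspace omega_star)) outer" by (simp add: positive_def)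
  show "increasing (Pow (topspace omega_star)) outer" by (simp add: increasing_def outer_mono)
  show "countably_subadditive (Pow (topspace omega_star)) outer"
    unfolding countably_subadditive_def
  proof (intro allI impI)
    fix S :: "nat \<Rightarrow> nat filter set"
    assume S: "range S \<subseteq> Pow (topspace omega_star)"
    show "outer (\<Union>i. S i) \<le> (\<Sum>i. outer (S i))"
    proof (rule ennreal_le_epsilon)
      fix e :: real assume e: "0 < e" and "(\<Sum>i. outer (S i)) < top"
      \<comment> \<open>A finite sum has finite terms, so these inequalities are strict; the margins
        add up to \<open>e\<close>.\<close>
      then have *: "outer (S i) < outer (S i) + e * (1/2)^Suc i" for i
        by (auto simp add: less_top dest!: ennreal_suminf_lessD)
      have "\<exists>G. openin omega_star G \<and> S i \<subseteq> G \<and> content G \<le> outer (S i) + e * (1/2)^Suc i" for i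
        using *[of i] unfolding outer_def[of "S i"] INF_less_iff by (auto intro: less_imp_le)
      then obtain G where G: "\<And>i. openin omega_star (G i)" "\<And>i. S i \<subseteq> G i"
        "\<And>i. content (G i) \<le> outer (S i) + e * (1/2)^Suc i" by metis
      have "outer (\<Union>i. S i) \<le> content (\<Union>i. G i)" using G by (intro outer_le) auto
      also have "\<dots> \<le> (\<Sum>i. content (G i))" using G by (intro content_UN_le)
      also have "\<dots> \<le> (\<Sum>i. outer (S i) + e * (1/2)^Suc i)" using G by (intro suminf_le) auto
      also have "\<dots> = (\<Sum>i. outer (S i)) + (\<Sum>i. ennreal e * ennreal ((1/2) ^ Suc i))"
        using e by (subst suminf_add[symmetric])
          (auto simp del: ennreal_suminf_cmult simp add: ennreal_mult[symmetric])
      also have "\<dots> = (\<Sum>i. outer (S i)) + e"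
        unfolding ennreal_suminf_cmult
        by (subst suminf_ennreal_eq[OF zero_le_power power_half_series]) auto
      finally show "outer (\<Union>i. S i) \<le> (\<Sum>i. outer (S i)) + ennreal e" .
    qed
  qed
qed

lemma outer_subadd:
  assumes "S \<subseteq> topspace omega_star" "T \<subseteq> topspace omega_star" "S \<inter> T = {}"
  shows "outer (S \<union> T) \<le> outer S + outer T"
proof -
  interpret sigma_algebra "topspace omega_star" "Pow (topspace omega_star)"
    by (rule sigma_algebra_Pow)
  have "subadditive (Pow (topspace omega_star)) outer"
    using outer_measure_space_outer unfolding outer_measure_space_def
    by (blast intro: countably_subadditive_subadditive)
  then show ?thesis using assms by (intro subadditiveD) auto
qed

text \<open>Exhaust \<open>H0 \<inter> G\<close> by clopen sets \<open>hat A\<close>. The rest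
  \<open>H0 - hat A\<close> is open and contains \<open>H0 - G\<close>; for \<open>hat B\<close>
  inside it, \<open>A \<inter> B\<close> is finite, so
  \<open>m A + m B = m (A \<union> B)\<close>.\<close>

lemma openin_split:
  assumes O: "openin omega_star H0" and G: "openin omega_star G"
  shows "outer (H0 \<inter> G) + outer (H0 - G) \<le> content H0"
proof -
  have 1: "m A + outer (H0 - G) \<le> content H0" if A: "hat A \<subseteq> H0 \<inter> G" for A
  proof -
    have op: "openin omega_star (H0 - hat A)" using O closedin_hat by (rule openin_diff)
    have "outer (H0 - G) \<le> content (H0 - hat A)" using A by (intro outer_le op) auto
    then have "m A + outer (H0 - G) \<le> m A + content (H0 - hat A)" by (rule add_left_mono)
    also have "\<dots> = (SUP B\<in>{B. hat B \<subseteq> H0 - hat A}. m A + m B)"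
      unfolding content_def
    proof (rule ennreal_SUP_add_right)
      have "hat {} \<subseteq> H0 - hat A" by (simp add: hat_empty)
      then show "{B. hat B \<subseteq> H0 - hat A} \<noteq> {}" by blast
    qed
    also have "\<dots> \<le> content H0"
    proof (rule SUP_least)
      fix B assume B: "B \<in> {B. hat B \<subseteq> H0 - hat A}"
      then have "hat (A \<inter> B) \<subseteq> hat {}" by (auto simp: hat_Int)
      then have fin: "finite (A \<inter> B)" by (simp add: hat_subset_iff)
      have "m A + m B \<le> m A + m (B - A)"
        using fin by (intro add_left_mono m_mono) (simp add: Diff_Diff_Int Int_commute)
      also have "\<dots> = m (A \<union> B)" by (subst m_Un[symmetric]) auto
      also have "\<dots> \<le> content H0"
      proof (rule le_content)
        show "hat (A \<union> B) \<subseteq> H0"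
          using A B by (auto simp: hat_Un)
      qed
      finally show "m A + m B \<le> content H0" .
    qed
    finally show ?thesis .
  qed
  have "outer (H0 \<inter> G) + outer (H0 - G) = outer (H0 - G) + (SUP A\<in>{A. hat A \<subseteq> H0 \<inter> G}. m A)"
    using O G by (simp add: outer_openin openin_Int content_def add.commute)
  also have "\<dots> = (SUP A\<in>{A. hat A \<subseteq> H0 \<inter> G}. outer (H0 - G) + m A)"
  proof (rule ennreal_SUP_add_right)
    have "hat {} \<subseteq> H0 \<inter> G" by (simp add: hat_empty)
    then show "{A. hat A \<subseteq> H0 \<inter> G} \<noteq> {}" by blast
  qed
  also have "\<dots> \<le> content H0" using 1 by (intro SUP_least) (auto simp: add.commute)
  finally show ?thesis .
qed

text \<open>Caratheodory's condition: the inequality for open sets passes to the infimum over open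
  supersets, and the converse is subadditivity.\<close>

lemma outer_split:
  assumes S: "S \<subseteq> topspace omega_star" and G: "openin omega_star G"
  shows "outer (S \<inter> G) + outer (S - G) = outer S"
proof (rule antisym)
  show "outer (S \<inter> G) + outer (S - G) \<le> outer S"
    unfolding outer_def[of S]
  proof (rule INF_greatest)
    fix H assume "H \<in> {H. openin omega_star H \<and> S \<subseteq> H}"
    then have H: "openin omega_star H" "S \<subseteq> H" by auto
    have "outer (S \<inter> G) + outer (S - G) \<le> outer (H \<inter> G) + outer (H - G)"
      using H(2) by (intro add_mono outer_mono) auto
    also have "\<dots> \<le> content H" by (rule openin_split[OF H(1) G])
    finally show "outer (S \<inter> G) + outer (S - G) \<le> content H" .
  qed
  show "outer S \<le> outer (S \<inter> G) + outer (S - G)"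
  proof -
    have "outer ((S \<inter> G) \<union> (S - G)) \<le> outer (S \<inter> G) + outer (S - G)"
      using S by (intro outer_subadd) auto
    then show ?thesis by (simp add: Int_Diff_Un)
  qed
qed

section \<open>The Borel extension: regularity, atoms and support\<close>

definition extension :: "nat filter measure" where
  "extension = measure_of (topspace omega_star) {U. openin omega_star U} outer"

lemma opens_Pow: "{U. openin omega_star U} \<subseteq> Pow (topspace omega_star)"
  using openin_subset by auto

lemma space_extension: "space extension = topspace omega_star"
  unfolding extension_def using opens_Pow by (simp add: space_measure_of)

lemma sets_extension: "sets extension = sigma_sets (topspace omega_star) {U. openin omega_star U}"
  unfolding extension_def using opens_Pow by (simp add: sets_measure_of)

lemma openin_sets: "openin omega_star U \<Longrightarrow> U \<in> sets extension"
  by (auto simp: sets_extension)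

lemma closedin_sets: "closedin omega_star U \<Longrightarrow> U \<in> sets extension"
  using sets.compl_sets[OF openin_sets, of "topspace omega_star - U"]
  by (auto simp: closedin_def space_extension double_diff)

text \<open>The sets that split every set form a sigma-algebra on which \<open>outer\<close> is a
  measure. It contains the open sets by \<open>outer_split\<close>, hence all Borel sets.\<close>

lemma emeasure_extension:
  assumes "S \<in> sets extension"
  shows "emeasure extension S = outer S"
proof (rule emeasure_measure_of[OF extension_def opens_Pow _ _ assms])
  let ?\<Omega> = "topspace omega_star"
  let ?L = "lambda_system ?\<Omega> (Pow ?\<Omega>) outer"
  interpret sigma_algebra ?\<Omega> "Pow ?\<Omega>" by (rule sigma_algebra_Pow)
  have ms: "measure_space ?\<Omega> ?L outer"
    using outer_measure_space_outer by (rule caratheodory_lemma)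
  have "{U. openin omega_star U} \<subseteq> ?L"
    using openin_subset outer_split by (auto simp: lambda_system_eq)
  then have sub: "sets extension \<subseteq> ?L"
    unfolding sets_extension using ms
    by (intro sigma_algebra.sigma_sets_subset) (auto simp: measure_space_def)
  show "positive (sets extension) outer"
    using ms by (auto simp: measure_space_def positive_def)
  show "countably_additive (sets extension) outer"
    using ms sub unfolding measure_space_def countably_additive_def by blast
qed

lemma emeasure_extension_hat: "emeasure extension (hat A) = m A"
  by (simp add: emeasure_extension openin_sets openin_hat outer_hat)

lemma emeasure_extension_space: "emeasure extension (space extension) = 1"
  using emeasure_extension_hat[of UNIV] by (simp add: space_extension hat_UNIV m_UNIV)

text \<open>Outer regularity is built into \<open>outer\<close>. Applied to the complement of
  \<open>B\<close>, it gives a closed subset of \<open>B\<close> of nearly full measure, and closed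
  sets are compact here.\<close>

lemma radon_extension: "radon_prob_measure omega_star extension"
  unfolding radon_prob_measure_def
proof (intro conjI ballI)
  show "sets extension = sets (sigma (topspace omega_star) {U. openin omega_star U})"
    using opens_Pow by (simp add: sets_extension sets_measure_of)
  interpret prob: finite_measure extension
    by standard (simp add: emeasure_extension_space)
  fix B assume B: "B \<in> sets extension"
  let ?K = "{K. compactin omega_star K \<and> K \<in> sets extension \<and> K \<subseteq> B}"
  show "emeasure extension B = (SUP K\<in>?K. emeasure extension K)"
  proof (rule antisym)
    show "emeasure extension B \<le> (SUP K\<in>?K. emeasure extension K)"
    proof (rule ennreal_le_epsilon)
      fix e :: real assume e: "0 < e"
      let ?B' = "space extension - B"
      have B': "?B' \<in> sets extension" using B by auto
      define c where "c = outer ?B' + ennreal e"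
      have "outer ?B' < c"
        unfolding c_def using e prob.emeasure_finite[of ?B'] B' by (simp add: emeasure_extension less_top)
      then obtain G where G: "openin omega_star G" "?B' \<subseteq> G" "content G < c"
        unfolding outer_def INF_less_iff by blast
      let ?K = "space extension - G"
      have K: "closedin omega_star ?K" using G(1) by (simp add: space_extension closedin_diff)
      have Ks: "?K \<in> sets extension" using K by (rule closedin_sets)
      have KB: "?K \<subseteq> B" using G(2) by auto
      have "emeasure extension (G - ?B') \<le> ennreal e"
      proof -
        have "emeasure extension (G - ?B') + emeasure extension ?B' = emeasure extension G"
          using G B' openin_sets[OF G(1)] by (subst plus_emeasure) (auto simp: Un_absorb2)
        also have "\<dots> \<le> ennreal e + emeasure extension ?B'"
          using G B' unfolding c_def
          by (simp add: emeasure_extension openin_sets outer_openin less_imp_le add.commute)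
        finally show ?thesis
          using prob.emeasure_finite[of ?B'] by (simp add: ennreal_add_left_cancel_le add.commute)
      qed
      moreover have "B \<subseteq> ?K \<union> (G - ?B')"
        using sets.sets_into_space[OF B] by auto
      then have "emeasure extension B \<le> emeasure extension (?K \<union> (G - ?B'))"
        using Ks B' openin_sets[OF G(1)] by (intro emeasure_mono) auto
      moreover have "\<dots> \<le> emeasure extension ?K + emeasure extension (G - ?B')"
        using Ks B' openin_sets[OF G(1)] by (intro emeasure_subadditive) auto
      ultimately have "emeasure extension B \<le> emeasure extension ?K + ennreal e"
        by (meson add_left_mono order_trans)
      moreover have "compactin omega_star ?K"
        using compact_space_omega_star K by (rule closedin_compact_space)
      then have "emeasure extension ?K \<le> (SUP K\<in>{K. compactin omega_star K \<and> K \<in> sets extension \<and> K \<subseteq> B}. emeasure extension K)"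
        using Ks KB by (intro SUP_upper) auto
      ultimately show "emeasure extension B \<le> (SUP K\<in>{K. compactin omega_star K \<and> K \<in> sets extension \<and> K \<subseteq> B}. emeasure extension K) + ennreal e"
        by (meson add_right_mono order_trans)
    qed
    show "(SUP K\<in>?K. emeasure extension K) \<le> emeasure extension B"
      using B by (intro SUP_least emeasure_mono) auto
  qed
qed (auto simp: space_extension emeasure_extension_space[unfolded space_extension])

text \<open>\<open>F\<close> lies in \<open>hat A\<close> for some member \<open>A\<close> of the
  finite cover, so its mass is at most \<open>e\<close>.\<close>

lemma nonatomic_extension:
  assumes "\<And>e::real. 0 < e \<Longrightarrow> \<exists>P. finite P \<and> \<Union>P = UNIV \<and> (\<forall>A\<in>P. m A \<le> ennreal e)"
  shows "nonatomic extension"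
  unfolding nonatomic_def
proof
  fix F assume "F \<in> space extension"
  then have F: "F \<in> topspace omega_star" by (simp add: space_extension)
  have "emeasure extension {F} \<le> 0"
  proof (rule ennreal_le_epsilon)
    fix e :: real assume "0 < e"
    then obtain P where P: "finite P" "\<Union>P = UNIV" "\<forall>A\<in>P. m A \<le> ennreal e"
      using assms[of e] by blast
    have "topspace omega_star = (\<Union>A\<in>P. hat A)"
      using hat_UN[OF P(1), of "\<lambda>A. A"] P(2) by (simp add: hat_UNIV)
    then obtain A where A: "A \<in> P" "F \<in> hat A" using F by auto
    have "emeasure extension {F} \<le> emeasure extension (hat A)"
      using A(2) by (intro emeasure_mono openin_sets openin_hat) auto
    then show "emeasure extension {F} \<le> 0 + ennreal e"
      using A(1) P(3) by (auto simp: emeasure_extension_hat intro: order_trans)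
  qed
  then show "emeasure extension {F} = 0" by simp
qed

text \<open>If \<open>F\<close> were outside a closed set of measure 1, a clopen neighbourhood
  \<open>hat A\<close> would miss that set, and additivity would force
  \<open>m A = 0\<close>.\<close>

lemma mem_measure_support_extension:
  assumes "F \<in> topspace omega_star" and pos: "\<And>A. eventually (\<lambda>n. n \<in> A) F \<Longrightarrow> m A \<noteq> 0"
  shows "F \<in> measure_support omega_star extension"
  unfolding measure_support_def
proof (intro InterI, clarify)
  fix C assume C: "closedin omega_star C" "emeasure extension C = 1"
  show "F \<in> C"
  proof (rule ccontr)
    assume "F \<notin> C"
    then obtain A where A: "F \<in> hat A" "hat A \<subseteq> topspace omega_star - C"
      using assms(1) C(1) openin_omega_star_base[of "topspace omega_star - C" F]
      by (auto simp: closedin_def)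
    have "m A + 1 = emeasure extension (hat A) + emeasure extension C"
      by (simp add: emeasure_extension_hat C(2))
    also have "\<dots> = emeasure extension (hat A \<union> C)"
      using A(2) by (intro plus_emeasure openin_sets openin_hat closedin_sets C) auto
    also have "\<dots> \<le> 1"
      using emeasure_space[of extension "hat A \<union> C"] by (simp add: emeasure_extension_space)
    finally have "m A = 0" using ennreal_add_left_cancel_le[of 1 "m A" 0] by (simp add: add.commute)
    moreover have "m A \<noteq> 0" using A(1) by (intro pos) (auto simp: hat_def)
    ultimately show False by simp
  qed
qed

end

section \<open>Filters from independent constraints\<close>

text \<open>\<open>F\<close> generates the filter built so far, \<open>K\<close> holds the indices already used up, and any
  finitely many constraints \<open>e k\<close> at unused indices remain compatible with \<open>F\<close> modulo the ideal
  \<open>J\<close>.\<close>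

definition indep :: "'a set set \<Rightarrow> ('k \<Rightarrow> 'a set set) \<Rightarrow> 'a set set \<Rightarrow> 'k set \<Rightarrow> bool" where
  "indep J E F K \<longleftrightarrow> (\<forall>X S e. finite X \<longrightarrow> X \<subseteq> F \<longrightarrow> finite S \<longrightarrow> S \<inter> K = {} \<longrightarrow>
     (\<forall>k\<in>S. e k \<in> E k) \<longrightarrow> \<Inter>X \<inter> (\<Inter>k\<in>S. e k) \<notin> J)"

lemma indepD:
  assumes "indep J E F K" "finite X" "X \<subseteq> F" "finite S" "S \<inter> K = {}" "\<And>k. k \<in> S \<Longrightarrow> e k \<in> E k"
  shows "\<Inter>X \<inter> (\<Inter>k\<in>S. e k) \<notin> J"
  using assms unfolding indep_def by blast

text \<open>Either some constraints force a \<open>U N\<close> out of the filter, and then adding them uses up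
  finitely many indices, or all sets in \<open>V k\<close> can be added at once.\<close>

lemma indep_step:
  fixes U :: "nat \<Rightarrow> 'a set"
  assumes down: "\<And>A B. A \<subseteq> B \<Longrightarrow> B \<in> J \<Longrightarrow> A \<in> J"
    and V: "\<And>k X. finite X \<Longrightarrow> X \<subseteq> V k \<Longrightarrow> \<exists>N. \<exists>e\<in>E k. e \<inter> U N \<subseteq> \<Inter>X"
    and ind: "indep J E F K" and K: "k \<notin> K"
  obtains G L where "finite L" "indep J E (F \<union> G) (K \<union> L)"
    "V k \<subseteq> G \<or> (\<exists>X N. finite X \<and> X \<subseteq> F \<union> G \<and> \<Inter>X \<inter> U N \<in> J)"
proof (cases "\<exists>X S e N. finite X \<and> X \<subseteq> F \<and> finite S \<and> S \<inter> K = {} \<and> (\<forall>k\<in>S. e k \<in> E k) \<and>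
    \<Inter>X \<inter> (\<Inter>k\<in>S. e k) \<inter> U N \<in> J")
  case True
  then obtain X S e N where 1: "finite X" "X \<subseteq> F" "finite S" "S \<inter> K = {}"
    "\<And>k. k \<in> S \<Longrightarrow> e k \<in> E k" "\<Inter>X \<inter> (\<Inter>k\<in>S. e k) \<inter> U N \<in> J" by metis
  let ?G = "e ` S"
  have "indep J E (F \<union> ?G) (K \<union> S)"
    unfolding indep_def
  proof (intro allI impI)
    fix Y T d assume 2: "finite Y" "Y \<subseteq> F \<union> ?G" "finite T" "T \<inter> (K \<union> S) = {}" "\<forall>k\<in>T. d k \<in> E k"
    \<comment> \<open>\<open>T\<close> avoids \<open>S\<close>, so old and new constraints glue to
      one choice, and a single instance of \<open>ind\<close> covers both.\<close>
    let ?h = "\<lambda>k. if k \<in> S then e k else d k"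
    have "\<Inter>(Y \<inter> F) \<inter> (\<Inter>k\<in>S \<union> T. ?h k) \<notin> J"
      by (rule indepD[OF ind]) (use 1 2 in auto)
    moreover have "\<Inter>(Y \<inter> F) \<inter> (\<Inter>k\<in>S \<union> T. ?h k) \<subseteq> \<Inter>Y \<inter> (\<Inter>k\<in>T. d k)"
    proof
      fix x assume x: "x \<in> \<Inter>(Y \<inter> F) \<inter> (\<Inter>k\<in>S \<union> T. ?h k)"
      have "x \<in> e k" if "k \<in> S" for k using x that by force
      moreover have "x \<in> d k" if "k \<in> T" for k using x that 2(4) by fastforce
      ultimately show "x \<in> \<Inter>Y \<inter> (\<Inter>k\<in>T. d k)" using x 2(2) by auto
    qed
    ultimately show "\<Inter>Y \<inter> (\<Inter>k\<in>T. d k) \<notin> J" using down by blast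
  qed
  moreover have "\<Inter>(X \<union> ?G) \<inter> U N \<in> J" using 1(6) by (simp add: Inter_Un_distrib)
  ultimately show ?thesis
    using that[of S ?G] 1 by (metis finite_UnI finite_imageI sup.mono order_refl)
next
  case False
  have "indep J E (F \<union> V k) (K \<union> {k})"
    unfolding indep_def
  proof (intro allI impI)
    fix Y T d assume 2: "finite Y" "Y \<subseteq> F \<union> V k" "finite T" "T \<inter> (K \<union> {k}) = {}" "\<forall>k\<in>T. d k \<in> E k"
    \<comment> \<open>One constraint at the fresh index \<open>k\<close> together with one
      \<open>U N\<close> implies all the new sets in \<open>Y\<close>; by \<open>False\<close> the
      intersection stays outside \<open>J\<close> even after cutting with
      \<open>U N\<close>.\<close>
    obtain N e where e: "e \<in> E k" "e \<inter> U N \<subseteq> \<Inter>(Y \<inter> V k)" using V[of "Y \<inter> V k" k] 2 by auto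
    let ?h = "d(k := e)"
    have "\<Inter>(Y \<inter> F) \<inter> (\<Inter>k\<in>insert k T. ?h k) \<inter> U N \<notin> J"
    proof -
      have "finite (Y \<inter> F)" "Y \<inter> F \<subseteq> F" "finite (insert k T)" "insert k T \<inter> K = {}"
        "\<forall>l\<in>insert k T. ?h l \<in> E l" using 2 e K by auto
      then show ?thesis using False by blast
    qed
    moreover have "\<Inter>(Y \<inter> F) \<inter> (\<Inter>k\<in>insert k T. ?h k) \<inter> U N \<subseteq> \<Inter>Y \<inter> (\<Inter>k\<in>T. d k)"
    proof
      fix x assume x: "x \<in> \<Inter>(Y \<inter> F) \<inter> (\<Inter>k\<in>insert k T. ?h k) \<inter> U N"
      then have "x \<in> e \<inter> U N" by auto
      then have "x \<in> \<Inter>(Y \<inter> V k)" using e by blast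
      moreover have "x \<in> d l" if "l \<in> T" for l
      proof -
        have "l \<noteq> k" using that 2(4) by auto
        then show ?thesis using x that by auto
      qed
      ultimately show "x \<in> \<Inter>Y \<inter> (\<Inter>k\<in>T. d k)" using x 2(2) by blast
    qed
    ultimately show "\<Inter>Y \<inter> (\<Inter>k\<in>T. d k) \<notin> J" using down by blast
  qed
  then show ?thesis using that[of "{k}" "V k"] by auto
qed

text \<open>A proper initial segment of a cardinal well-order has smaller cardinality, and finite
  sets indexed by it cannot make up the difference. The recursion gets a fresh index at each stage
  from this.\<close>

lemma UN_finite_underS_neq_UNIV:
  includes cardinal_syntax
  fixes K :: "'k \<Rightarrow> 'l set"
  assumes inf: "infinite (UNIV :: 'k set)" and fin: "\<And>s. s \<in> underS |UNIV :: 'k set| t \<Longrightarrow> finite (K s)"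
    and le: "|UNIV :: 'k set| \<le>o |UNIV :: 'l set|"
  shows "(\<Union>s\<in>underS |UNIV :: 'k set| t. K s) \<noteq> UNIV"
proof
  let ?B = "underS |UNIV :: 'k set| t"
  assume eq: "(\<Union>s\<in>?B. K s) = UNIV"
  have less: "|?B| <o |UNIV :: 'l set|"
    using card_of_underS[OF card_of_Card_order, of t UNIV] le
    by (simp add: Field_card_of ordLess_ordLeq_trans)
  have infl: "infinite (UNIV :: 'l set)"
    using le inf card_of_ordLeq_finite by blast
  show False
  proof (cases "finite ?B")
    case True
    then show False using fin eq infl by (metis finite_UN)
  next
    case False
    have "|\<Union>s\<in>?B. K s| \<le>o |?B|"
    proof (rule card_of_UNION_ordLeq_infinite[OF False])
      show "|?B| \<le>o |?B|" by (rule ordLeq_refl) (rule card_of_Card_order)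
      show "\<forall>s\<in>?B. |K s| \<le>o |?B|"
        using fin False
        by (intro ballI ordLess_imp_ordLeq finite_ordLess_infinite card_of_Well_order)
          (simp_all add: Field_card_of)
    qed
    then show False using less eq not_ordLess_ordLeq by auto
  qed
qed

text \<open>Independence has finite character: a finite nonempty \<open>X\<close> lies in a single
  \<open>F t\<close> of the chain, and \<open>S\<close> avoids that \<open>K t\<close>. The case
  \<open>X = {}\<close> is left to \<open>ne\<close>, which also covers an empty chain.\<close>

lemma indep_Union:
  assumes tot: "\<And>s t. s \<in> I \<Longrightarrow> t \<in> I \<Longrightarrow> F s \<subseteq> F t \<and> K s \<subseteq> K t \<or> F t \<subseteq> F s \<and> K t \<subseteq> K s"
    and ind: "\<And>t. t \<in> I \<Longrightarrow> indep J E (F t) (K t)" and ne: "indep J E {} {}"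
  shows "indep J E (\<Union>t\<in>I. F t) (\<Union>t\<in>I. K t)"
  unfolding indep_def
proof (intro allI impI)
  fix X S e assume X: "finite X" "X \<subseteq> (\<Union>t\<in>I. F t)"
    and S: "finite S" "S \<inter> (\<Union>t\<in>I. K t) = {}" "\<forall>k\<in>S. e k \<in> E k"
  show "\<Inter>X \<inter> (\<Inter>k\<in>S. e k) \<notin> J"
  proof (cases "X = {}")
    case True
    then show ?thesis using indepD[OF ne, of "{}" S e] S by auto
  next
    case False
    have "\<exists>t\<in>I. X \<subseteq> F t" using X(1) False X(2)
    proof (induction rule: finite_ne_induct)
      case (insert x X)
      then obtain s t where "s \<in> I" "X \<subseteq> F s" "t \<in> I" "x \<in> F t" by auto
      then show ?case using tot[of s t] by auto
    qed auto
    then obtain t where "t \<in> I" "X \<subseteq> F t" by auto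
    then show ?thesis using indepD[OF ind, of t X S e] X S by blast
  qed
qed

text \<open>Recursion along the cardinal well-order of \<open>'k\<close>, with one task
  \<open>t\<close> per stage. Each stage consumes finitely many indices, so
  \<open>indep_step\<close> always finds a fresh one.\<close>

lemma indep_family:
  includes cardinal_syntax
  fixes E :: "'k \<Rightarrow> 'a set set" and U :: "'k \<Rightarrow> nat \<Rightarrow> 'a set"
  assumes inf: "infinite (UNIV :: 'k set)"
    and down: "\<And>A B. A \<subseteq> B \<Longrightarrow> B \<in> J \<Longrightarrow> A \<in> J"
    and V: "\<And>t k X. finite X \<Longrightarrow> X \<subseteq> V t k \<Longrightarrow> \<exists>N. \<exists>e\<in>E k. e \<inter> U t N \<subseteq> \<Inter>X"
    and ind: "indep J E {} {}"
  shows "\<exists>F. (\<forall>X. finite X \<longrightarrow> X \<subseteq> F \<longrightarrow> \<Inter>X \<notin> J) \<and>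
    (\<forall>t. (\<exists>k. V t k \<subseteq> F) \<or> (\<exists>X N. finite X \<and> X \<subseteq> F \<and> \<Inter>X \<inter> U t N \<in> J))"
proof -
  let ?r = "|UNIV :: 'k set|"
  let ?R = "?r - Id"
  have wo: "wo_rel ?r" by (simp add: wo_rel_def card_of_Well_order)
  have wf: "wf ?R" using wo_rel.WF[OF wo] .
  have underS: "s \<in> underS ?r t \<longleftrightarrow> (s, t) \<in> ?R" for s t by (auto simp: underS_def)
  have trans: "s \<in> underS ?r t" if "s \<in> underS ?r u" "u \<in> underS ?r t" for s t u
    using that wo_rel.TRANS[OF wo] wo_rel.ANTISYM[OF wo] unfolding underS_def
    by (auto dest: transD antisymD)
  have total: "s = t \<or> s \<in> underS ?r t \<or> t \<in> underS ?r s" for s t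
    using wo_rel.TOTAL[OF wo] unfolding total_on_def underS_def by (auto simp: Field_card_of)
  define Fu where "Fu = (\<lambda>f :: 'k \<Rightarrow> 'a set set \<times> 'k set. \<lambda>t. \<Union>s\<in>underS ?r t. fst (f s))"
  define Ku where "Ku = (\<lambda>f :: 'k \<Rightarrow> 'a set set \<times> 'k set. \<lambda>t. \<Union>s\<in>underS ?r t. snd (f s))"
  \<comment> \<open>\<open>GL\<close> pairs the sets added at stage \<open>t\<close> with the
    indices consumed there; \<open>Fu\<close> and \<open>Ku\<close> collect those of the earlier
    stages.\<close>
  define P where "P = (\<lambda>f t GL. finite (snd GL) \<and> indep J E (Fu f t \<union> fst GL) (Ku f t \<union> snd GL) \<and>
    ((\<exists>k. V t k \<subseteq> fst GL) \<or> (\<exists>X N. finite X \<and> X \<subseteq> Fu f t \<union> fst GL \<and> \<Inter>X \<inter> U t N \<in> J)))"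
  \<comment> \<open>\<open>I\<close> is any downward closed set, so that this serves every stage
    and, with \<open>I = UNIV\<close>, the end of the recursion.\<close>
  have ind_stage: "indep J E (\<Union>s\<in>I. fst (f s)) (\<Union>s\<in>I. snd (f s))"
    if I: "\<And>s t. t \<in> I \<Longrightarrow> s \<in> underS ?r t \<Longrightarrow> s \<in> I" and P: "\<And>s. s \<in> I \<Longrightarrow> P f s (f s)" for f I
  proof -
    let ?F = "\<lambda>s. Fu f s \<union> fst (f s)" and ?K = "\<lambda>s. Ku f s \<union> snd (f s)"
    have "indep J E (\<Union>s\<in>I. ?F s) (\<Union>s\<in>I. ?K s)"
    proof (rule indep_Union[OF _ _ ind])
      have mono: "?F s \<subseteq> ?F t \<and> ?K s \<subseteq> ?K t" if "s \<in> underS ?r t" for s t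
        using that trans unfolding Fu_def Ku_def by blast
      show "?F s \<subseteq> ?F t \<and> ?K s \<subseteq> ?K t \<or> ?F t \<subseteq> ?F s \<and> ?K t \<subseteq> ?K s" for s t
        using total[of s t] mono[of s t] mono[of t s] by blast
      show "indep J E (?F s) (?K s)" if "s \<in> I" for s
        using P[OF that] by (simp add: P_def)
    qed
    moreover have "(\<Union>s\<in>I. ?F s) = (\<Union>s\<in>I. fst (f s))" "(\<Union>s\<in>I. ?K s) = (\<Union>s\<in>I. snd (f s))"
      using I unfolding Fu_def Ku_def by blast+
    ultimately show ?thesis by simp
  qed
  have "\<exists>f. \<forall>t. P f t (f t)"
  proof (rule dependent_wf_choice[OF wf])
    fix f g :: "'k \<Rightarrow> 'a set set \<times> 'k set" and t GL
    assume "\<And>z. (z, t) \<in> ?R \<Longrightarrow> f z = g z"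
    then have "Fu f t = Fu g t" "Ku f t = Ku g t" by (auto simp: Fu_def Ku_def underS)
    then show "P f t GL = P g t GL" by (simp add: P_def)
  next
    fix t f assume "\<And>s. (s, t) \<in> ?R \<Longrightarrow> P f s (f s)"
    then have IH: "P f s (f s)" if "s \<in> underS ?r t" for s using that underS by blast
    have ind_t: "indep J E (Fu f t) (Ku f t)"
      unfolding Fu_def Ku_def using trans IH by (intro ind_stage)
    have "Ku f t \<noteq> UNIV"
      unfolding Ku_def using IH
      by (intro UN_finite_underS_neq_UNIV inf ordLeq_refl card_of_Card_order) (auto simp: P_def)
    then obtain k where k: "k \<notin> Ku f t" by auto
    obtain G L where "finite L" "indep J E (Fu f t \<union> G) (Ku f t \<union> L)"
      "V t k \<subseteq> G \<or> (\<exists>X N. finite X \<and> X \<subseteq> Fu f t \<union> G \<and> \<Inter>X \<inter> U t N \<in> J)"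
      by (rule indep_step[OF down V[where t = t] ind_t k])
    then show "\<exists>GL. P f t GL" by (intro exI[of _ "(G, L)"]) (auto simp: P_def)
  qed
  then obtain f where f: "\<And>t. P f t (f t)" by auto
  let ?F = "\<Union>s. fst (f s)"
  have "indep J E ?F (\<Union>s. snd (f s))"
    using ind_stage[of UNIV f] f by simp
  then have "\<Inter>X \<notin> J" if "finite X" "X \<subseteq> ?F" for X
    using indepD[of J E ?F _ X "{}"] that by auto
  moreover have "(\<exists>k. V t k \<subseteq> ?F) \<or> (\<exists>X N. finite X \<and> X \<subseteq> ?F \<and> \<Inter>X \<inter> U t N \<in> J)" for t
  proof -
    have "Fu f t \<union> fst (f t) \<subseteq> ?F" unfolding Fu_def by blast
    then show ?thesis using f[of t] unfolding P_def by (meson Un_upper2 order_trans)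
  qed
  ultimately show ?thesis by blast
qed

section \<open>Independent partitions\<close>

definition trees :: "nat \<Rightarrow> (nat set \<Rightarrow> nat) set" where
  "trees n = Pow {..<n} \<rightarrow>\<^sub>E {..<2 ^ n}"

text \<open>Numbering the pairs by \<open>nat\<close> turns ultrafilters and charges on them into
  ones on omega.\<close>

definition point :: "nat \<Rightarrow> nat \<times> (nat set \<Rightarrow> nat)" where
  "point = from_nat_into (Sigma UNIV trees)"

definition level :: "nat \<Rightarrow> nat" where
  "level x = fst (point x)"

definition val :: "nat set \<Rightarrow> nat \<Rightarrow> nat" where
  "val k x = snd (point x) (k \<inter> {..<level x})"

definition density :: "nat \<Rightarrow> nat set \<Rightarrow> real" where
  "density n A = card {x \<in> A. level x = n} / card (trees n)"

section \<open>Finite levels and their normalised counting measures\<close>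

lemma card_trees: "card (trees n) = (2 ^ n) ^ (2 ^ n)"
  by (simp add: trees_def card_PiE card_Pow)

lemma finite_trees: "finite (trees n)"
  by (simp add: trees_def finite_PiE)

lemma bij_betw_point: "bij_betw point UNIV (Sigma UNIV trees)"
  unfolding point_def
proof (rule bij_betw_from_nat_into)
  show "countable (Sigma UNIV trees)"
    by (rule countable_SIGMA) (auto intro: countable_finite finite_trees)
  have "card (trees n) \<noteq> 0" for n by (simp add: card_trees)
  then have "trees n \<noteq> {}" for n by (metis card.empty)
  then have "fst ` (Sigma UNIV trees) = (UNIV :: nat set)" by force
  then show "infinite (Sigma UNIV trees)"
    by (metis finite_imageI infinite_UNIV_nat)
qed

lemma bij_betw_block: "bij_betw (\<lambda>x. snd (point x)) {x. level x = n} (trees n)"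
  unfolding bij_betw_def
proof
  show "inj_on (\<lambda>x. snd (point x)) {x. level x = n}"
  proof (rule inj_onI)
    fix x y assume "x \<in> {x. level x = n}" "y \<in> {x. level x = n}" "snd (point x) = snd (point y)"
    then have "point x = point y" by (intro prod_eqI) (auto simp: level_def)
    then show "x = y" using bij_betw_point by (auto simp: bij_betw_def dest: injD)
  qed
  show "(\<lambda>x. snd (point x)) ` {x. level x = n} = trees n"
  proof (intro set_eqI iffI)
    fix h assume "h \<in> (\<lambda>x. snd (point x)) ` {x. level x = n}"
    then obtain x where "h = snd (point x)" "fst (point x) = n" by (auto simp: level_def)
    moreover have "point x \<in> Sigma UNIV trees" using bij_betw_point by (auto simp: bij_betw_def)
    ultimately show "h \<in> trees n" by auto
  next
    fix h assume "h \<in> trees n"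
    then have "(n, h) \<in> point ` UNIV" using bij_betw_point by (auto simp: bij_betw_def)
    then obtain x where "point x = (n, h)" by (metis imageE)
    then show "h \<in> (\<lambda>x. snd (point x)) ` {x. level x = n}"
      by (intro image_eqI[of _ _ x]) (auto simp: level_def)
  qed
qed

lemma finite_block: "finite {x. level x = n}"
  using bij_betw_finite[OF bij_betw_block] finite_trees by simp

lemma val_less: "val k x < 2 ^ level x"
proof -
  have "snd (point x) \<in> trees (level x)"
    using bij_betw_block[of "level x"] by (auto simp: bij_betw_def)
  then have "snd (point x) (k \<inter> {..<level x}) \<in> {..<2 ^ level x}"
    unfolding trees_def by (rule PiE_mem) auto
  then show ?thesis by (simp add: val_def)
qed

lemma density_UNIV: "density n UNIV = 1"
  using bij_betw_same_card[OF bij_betw_block, of n] by (simp add: density_def card_trees)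

lemma density_mono: "A \<subseteq> B \<Longrightarrow> density n A \<le> density n B"
  unfolding density_def
  by (intro divide_right_mono of_nat_mono card_mono finite_subset[OF _ finite_block[of n]]) auto

lemma density_nonneg: "0 \<le> density n A"
  by (simp add: density_def)

lemma density_le_1: "density n A \<le> 1"
  using density_mono[of A UNIV n] by (simp add: density_UNIV)

lemma density_Un:
  assumes "A \<inter> B = {}"
  shows "density n (A \<union> B) = density n A + density n B"
proof -
  have "card {x \<in> A \<union> B. level x = n} = card ({x \<in> A. level x = n} \<union> {x \<in> B. level x = n})"
    by (rule arg_cong[where f = card]) auto
  also have "\<dots> = card {x \<in> A. level x = n} + card {x \<in> B. level x = n}"
    using assms by (intro card_Un_disjoint finite_subset[OF _ finite_block[of n]]) auto
  finally show ?thesis by (simp add: density_def add_divide_distrib)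
qed

lemma density_finite:
  assumes "finite A"
  shows "eventually (\<lambda>n. density n A = 0) sequentially"
proof -
  obtain k where "\<forall>n\<in>level ` A. n < k" using assms by (meson finite_imageI finite_nat_set_iff_bounded)
  then have "{x \<in> A. level x = n} = {}" if "k \<le> n" for n using that by fastforce
  then have "\<forall>n\<ge>k. density n A = 0" unfolding density_def by (metis card.empty div_0 of_nat_0)
  then show ?thesis by (auto simp: eventually_sequentially)
qed

text \<open>For a uniformly random member of \<open>trees n\<close> the coordinates are independent
  and uniform, and distinct traces \<open>k \<inter> {..<n}\<close> select distinct
  coordinates.\<close>

lemma density_val:
  assumes fin: "finite K" and inj: "inj_on (\<lambda>k. k \<inter> {..<n}) K"
    and G: "\<And>k. k \<in> K \<Longrightarrow> G k \<subseteq> {..<2 ^ n}"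
  shows "density n {x. \<forall>k\<in>K. val k x \<in> G k} = (\<Prod>k\<in>K. card (G k) / 2 ^ n)"
proof -
  let ?c = "\<lambda>k. k \<inter> {..<n}"
  \<comment> \<open>The constraints are extended by the full range to all other coordinates, so that
    the event becomes a product set; the added factors are 1.\<close>
  define H where "H s = (if s \<in> ?c ` K then G (inv_into K ?c s) else {..<2 ^ n})" for s
  have H: "H (?c k) = G k" if "k \<in> K" for k
    using that inv_into_f_f[OF inj that] by (simp add: H_def)
  have "bij_betw (\<lambda>x. snd (point x)) {x. (\<forall>k\<in>K. val k x \<in> G k) \<and> level x = n} (PiE (Pow {..<n}) H)"
  proof (rule bij_betw_subset[OF bij_betw_block[of n]])
    have "(\<lambda>x. snd (point x)) ` {x. (\<forall>k\<in>K. val k x \<in> G k) \<and> level x = n}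
        = (\<lambda>x. snd (point x)) ` {x \<in> {x. level x = n}. \<forall>k\<in>K. snd (point x) (?c k) \<in> G k}"
      by (rule arg_cong[where f = "image _"]) (auto simp: val_def)
    also have "\<dots> = {h \<in> (\<lambda>x. snd (point x)) ` {x. level x = n}. \<forall>k\<in>K. h (?c k) \<in> G k}"
      by auto
    also have "\<dots> = {h \<in> trees n. \<forall>k\<in>K. h (?c k) \<in> G k}"
      using bij_betw_imp_surj_on[OF bij_betw_block[of n]] by simp
    also have "\<dots> = PiE (Pow {..<n}) H"
    proof (intro set_eqI iffI)
      fix h assume h: "h \<in> {h \<in> trees n. \<forall>k\<in>K. h (?c k) \<in> G k}"
      show "h \<in> PiE (Pow {..<n}) H"
      proof (rule PiE_I)
        fix s assume s: "s \<in> Pow {..<n}"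
        show "h s \<in> H s"
        proof (cases "s \<in> ?c ` K")
          case True
          then show ?thesis using h H by auto
        next
          case False
          then show ?thesis using h s by (auto simp: H_def trees_def)
        qed
      next
        fix s assume "s \<notin> Pow {..<n}"
        moreover have "h \<in> Pow {..<n} \<rightarrow>\<^sub>E {..<2 ^ n}" using h by (simp add: trees_def)
        ultimately show "h s = undefined" by (metis PiE_arb)
      qed
    next
      fix h assume h: "h \<in> PiE (Pow {..<n}) H"
      have sub: "H s \<subseteq> {..<2 ^ n}" for s
      proof (cases "s \<in> ?c ` K")
        case True
        then have "inv_into K ?c s \<in> K" by (rule inv_into_into)
        then have "G (inv_into K ?c s) \<subseteq> {..<2 ^ n}" by (rule G)
        then show ?thesis using True by (simp only: H_def if_True)
      qed (simp add: H_def)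
      have "h \<in> trees n"
        unfolding trees_def
      proof (rule PiE_I)
        fix s assume "s \<in> Pow {..<n}"
        then show "h s \<in> {..<2 ^ n}" using PiE_mem[OF h] sub by blast
      next
        fix s assume "s \<notin> Pow {..<n}"
        then show "h s = undefined" by (rule PiE_arb[OF h])
      qed
      moreover have "h (?c k) \<in> G k" if "k \<in> K" for k
        using PiE_mem[OF h, of "?c k"] H[OF that] by auto
      ultimately show "h \<in> {h \<in> trees n. \<forall>k\<in>K. h (?c k) \<in> G k}" by blast
    qed
    finally show "(\<lambda>x. snd (point x)) ` {x. (\<forall>k\<in>K. val k x \<in> G k) \<and> level x = n} = PiE (Pow {..<n}) H" .
  qed auto
  then have "card {x. (\<forall>k\<in>K. val k x \<in> G k) \<and> level x = n} = card (PiE (Pow {..<n}) H)"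
    by (rule bij_betw_same_card)
  also have "\<dots> = (\<Prod>s\<in>Pow {..<n}. card (H s))"
    by (simp add: card_PiE)
  finally have "density n {x. \<forall>k\<in>K. val k x \<in> G k} = (\<Prod>s\<in>Pow {..<n}. real (card (H s))) / (\<Prod>s\<in>Pow {..<n}. 2 ^ n)"
    by (simp add: density_def card_trees card_Pow)
  also have "\<dots> = (\<Prod>s\<in>Pow {..<n}. card (H s) / 2 ^ n)"
    by (rule prod_dividef[symmetric])
  also have "\<dots> = (\<Prod>s\<in>?c ` K. card (H s) / 2 ^ n)"
    by (rule prod.mono_neutral_right) (auto simp: H_def)
  also have "\<dots> = (\<Prod>k\<in>K. card (G k) / 2 ^ n)"
    using inj H by (simp add: prod.reindex)
  finally show ?thesis .
qed

lemma eventually_inj_on_Int_lessThan: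
  assumes "finite (K :: nat set set)"
  shows "eventually (\<lambda>n. inj_on (\<lambda>k. k \<inter> {..<n}) K) sequentially"
proof -
  have "eventually (\<lambda>n. k \<inter> {..<n} = l \<inter> {..<n} \<longrightarrow> k = l) sequentially" for k l :: "nat set"
  proof (cases "k = l")
    case False
    then obtain x where x: "x \<in> k \<longleftrightarrow> x \<notin> l" by blast
    show ?thesis using eventually_gt_at_top[of x]
      by eventually_elim (use x in blast)
  qed simp
  then have "eventually (\<lambda>n. \<forall>k\<in>K. \<forall>l\<in>K. k \<inter> {..<n} = l \<inter> {..<n} \<longrightarrow> k = l) sequentially"
    using assms by (intro eventually_ball_finite ballI) auto
  then show ?thesis by eventually_elim (simp add: inj_on_def)
qed

section \<open>Avoiding residue classes modulo powers of 2\<close>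

lemma card_mod_power_le:
  assumes "j \<le> n"
  shows "card {t::nat. t < 2 ^ n \<and> t mod 2 ^ j = r} \<le> 2 ^ (n - j)"
proof -
  have "card {t::nat. t < 2 ^ n \<and> t mod 2 ^ j = r} \<le> card {..<(2::nat) ^ (n - j)}"
  proof (rule card_inj_on_le[where f = "\<lambda>t. t div 2 ^ j"])
    show "inj_on (\<lambda>t. t div 2 ^ j) {t::nat. t < 2 ^ n \<and> t mod 2 ^ j = r}"
      by (rule inj_onI) (metis (mono_tags, lifting) div_mult_mod_eq mem_Collect_eq)
    have "t div 2 ^ j < 2 ^ (n - j)" if "t < 2 ^ n" for t :: nat
      using that assms by (simp add: div_less_iff_less_mult flip: power_add)
    then show "(\<lambda>t. t div 2 ^ j) ` {t::nat. t < 2 ^ n \<and> t mod 2 ^ j = r} \<subseteq> {..<2 ^ (n - j)}" by auto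
  qed simp
  then show ?thesis by simp
qed

definition avoiding :: "nat \<Rightarrow> (nat \<Rightarrow> nat) set \<Rightarrow> nat \<Rightarrow> nat set" where
  "avoiding N I n = {t. t < 2 ^ n \<and> (\<forall>i\<in>I. \<forall>j\<in>{N<..n}. t mod 2 ^ j \<noteq> i j)}"

lemma sum_power_diff: "N \<le> n \<Longrightarrow> (\<Sum>j\<in>{N<..n}. 2 ^ (n - j)) + 1 = (2::nat) ^ (n - N)"
proof (induction n rule: nat_induct_at_least)
  case (Suc n)
  have "(\<Sum>j\<in>{N<..Suc n}. 2 ^ (Suc n - j)) = (\<Sum>j\<in>{N<..n}. 2 * 2 ^ (n - j)) + (1::nat)"
  proof -
    have "{N<..Suc n} = insert (Suc n) {N<..n}" using Suc.hyps by auto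
    then show ?thesis by (simp add: Suc_diff_le)
  qed
  also have "\<dots> + 1 = 2 * ((\<Sum>j\<in>{N<..n}. 2 ^ (n - j)) + 1)"
    by (simp add: sum_distrib_left)
  also have "\<dots> = 2 ^ (Suc n - N)" using Suc by (simp only: Suc.IH Suc_diff_le power_Suc)
  finally show ?case .
qed simp

text \<open>Union bound: each \<open>i\<close> excludes at most \<open>2 ^ (n - N) - 1\<close>
  values, and there are at most \<open>2 ^ N - 1\<close> such \<open>i\<close>, so at least
  \<open>2 ^ (n - N)\<close> of the \<open>2 ^ n\<close> values remain.\<close>

lemma card_avoiding:
  assumes I: "finite I" "card I < 2 ^ N" and n: "N \<le> n"
  shows "1 / 2 ^ N \<le> card (avoiding N I n) / 2 ^ n"
proof -
  let ?A = "avoiding N I n" and ?C = "\<Union>i\<in>I. \<Union>j\<in>{N<..n}. {t::nat. t < 2 ^ n \<and> t mod 2 ^ j = i j}"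
  have "card ?C \<le> (\<Sum>i\<in>I. \<Sum>j\<in>{N<..n}. 2 ^ (n - j))"
    by (intro order_trans[OF card_UN_le] sum_mono I card_mod_power_le) auto
  also have "\<dots> = card I * (2 ^ (n - N) - 1)" using sum_power_diff[OF n] by (simp flip: sum_power_diff[OF n])
  also have "\<dots> \<le> (2 ^ N - 1) * (2 ^ (n - N) - 1)" using I(2) by (intro mult_right_mono) auto
  finally have C: "card ?C \<le> (2 ^ N - 1) * (2 ^ (n - N) - 1)" .
  have "{..<2 ^ n} \<subseteq> ?A \<union> ?C" by (auto simp: avoiding_def)
  then have "card {..<(2::nat) ^ n} \<le> card (?A \<union> ?C)"
    using I(1) by (intro card_mono) (auto simp: avoiding_def)
  also have "\<dots> \<le> card ?A + card ?C" by (rule card_Un_le)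
  finally have "2 ^ n \<le> card ?A + (2 ^ N - 1) * (2 ^ (n - N) - 1)" using C by simp
  then have "real (2 ^ n) \<le> real (card ?A + (2 ^ N - 1) * (2 ^ (n - N) - 1))" by (rule of_nat_mono)
  then have "2 ^ n \<le> real (card ?A) + (2 ^ N - 1) * (2 ^ (n - N) - 1)" by (simp add: of_nat_diff)
  moreover have "(2::real) ^ n = 2 ^ N * 2 ^ (n - N)" using n by (simp flip: power_add)
  ultimately have "2 ^ N * 2 ^ (n - N) \<le> real (card ?A) + (2 ^ N - 1) * (2 ^ (n - N) - 1)" by simp
  then have "2 ^ (n - N) + (2 ^ N - 1) \<le> real (card ?A)" by (simp only: left_diff_distrib right_diff_distrib mult_1 mult_1_right)
  moreover have "(1::real) \<le> 2 ^ N" by simp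
  ultimately have "2 ^ (n - N) \<le> real (card ?A)" by linarith
  then have "2 ^ (n - N) / 2 ^ n \<le> real (card ?A) / 2 ^ n" by (intro divide_right_mono) auto
  moreover have "(2::real) ^ (n - N) / 2 ^ n = 1 / 2 ^ N" using n by (simp add: power_diff)
  ultimately show ?thesis by simp
qed

text \<open>For \<open>j > level x\<close> a class modulo \<open>2 ^ j\<close> holds at most one
  value and shrinks no further, so infinitely many of them could exclude a whole level; hence the
  cut at \<open>level x\<close>. For fixed \<open>j\<close> it affects only finitely many
  points.\<close>

definition avoid :: "nat set \<Rightarrow> nat \<Rightarrow> (nat \<Rightarrow> nat) set \<Rightarrow> nat set" where
  "avoid k N I = {x. \<forall>i\<in>I. \<forall>j\<in>{N<..level x}. val k x mod 2 ^ j \<noteq> i j}"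

text \<open>The bound \<open>card I < 2 ^ N\<close> leaves room: the avoided pieces have total density less than
  \<open>card I / 2 ^ N\<close>.\<close>

definition avoids :: "nat set \<Rightarrow> nat set set" where
  "avoids k = {avoid k N I | N I. finite I \<and> card I < 2 ^ N}"

text \<open>From some level on the traces of the finitely many \<open>k\<close> are distinct, so
  \<open>density_val\<close> gives a product, whose factors are bounded below by
  \<open>card_avoiding\<close>.\<close>

lemma density_avoids:
  assumes fin: "finite K" and e: "\<And>k. k \<in> K \<Longrightarrow> e k \<in> avoids k"
  shows "\<exists>c>0. eventually (\<lambda>n. c \<le> density n (\<Inter>k\<in>K. e k)) sequentially"
proof -
  have "\<forall>k\<in>K. \<exists>N I. e k = avoid k N I \<and> finite I \<and> card I < 2 ^ N"
    using e by (auto simp: avoids_def)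
  then obtain N I where NI: "\<And>k. k \<in> K \<Longrightarrow> e k = avoid k (N k) (I k)"
    "\<And>k. k \<in> K \<Longrightarrow> finite (I k)" "\<And>k. k \<in> K \<Longrightarrow> card (I k) < 2 ^ N k" by metis
  have "eventually (\<lambda>n. \<forall>k\<in>K. N k \<le> n) sequentially"
    using fin by (intro eventually_ball_finite ballI eventually_ge_at_top)
  with eventually_inj_on_Int_lessThan[OF fin]
  have "eventually (\<lambda>n. (\<Prod>k\<in>K. 1 / 2 ^ N k) \<le> density n (\<Inter>k\<in>K. e k)) sequentially"
  proof eventually_elim
    case (elim n)
    have "(\<Prod>k\<in>K. 1 / 2 ^ N k) \<le> (\<Prod>k\<in>K. card (avoiding (N k) (I k) n) / 2 ^ n)"
      using elim NI by (intro prod_mono conjI card_avoiding) auto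
    also have "\<dots> = density n {x. \<forall>k\<in>K. val k x \<in> avoiding (N k) (I k) n}"
      using fin elim by (intro density_val[symmetric]) (auto simp: avoiding_def)
    also have "\<dots> = density n (\<Inter>k\<in>K. e k)"
      unfolding density_def
      by (rule arg_cong[where f = "\<lambda>S. real (card S) / real (card (trees n))"])
        (use val_less NI(1) in \<open>auto simp: avoiding_def avoid_def\<close>)
    finally show ?case .
  qed
  moreover have "0 < (\<Prod>k\<in>K. 1 / 2 ^ N k :: real)" by (intro prod_pos) auto
  ultimately show ?thesis by blast
qed

lemma density_residue:
  assumes "j \<le> n"
  shows "density n {x. val k x mod 2 ^ j = r} \<le> 1 / 2 ^ j"
proof -
  let ?G = "{t::nat. t < 2 ^ n \<and> t mod 2 ^ j = r}"
  have "density n {x. val k x mod 2 ^ j = r} = density n {x. \<forall>k\<in>{k}. val k x \<in> ?G}"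
    unfolding density_def
    by (rule arg_cong[where f = "\<lambda>S. real (card S) / real (card (trees n))"]) (use val_less in auto)
  also have "\<dots> = card ?G / 2 ^ n" by (subst density_val) auto
  also have "\<dots> \<le> real (2 ^ (n - j)) / 2 ^ n"
    by (intro divide_right_mono of_nat_mono card_mod_power_le assms) auto
  also have "\<dots> = 1 / 2 ^ j" 
  proof -
    have "(2::real) ^ (n - j) * 2 ^ j = 2 ^ n" using assms by (simp flip: power_add)
    then show ?thesis by (simp add: field_simps)
  qed
  finally show ?thesis .
qed

section \<open>The weak P-point\<close>

text \<open>Decreasing sequences are coded by single sets, so that the tasks of the recursion and the
  indices have the same type.\<close>

definition seq_of_code :: "nat set \<Rightarrow> nat \<Rightarrow> nat set" where
  "seq_of_code t n = (\<Inter>i\<le>n. {x. prod_encode (i, x) \<in> t})"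

lemma seq_of_code_surj: "\<exists>t. \<forall>n. seq_of_code t n = (\<Inter>i\<le>n. A i)"
proof (intro exI allI)
  fix n
  show "seq_of_code {y. snd (prod_decode y) \<in> A (fst (prod_decode y))} n = (\<Inter>i\<le>n. A i)"
    by (simp add: seq_of_code_def)
qed

lemma seq_of_code_antimono: "m \<le> n \<Longrightarrow> seq_of_code t n \<subseteq> seq_of_code t m"
  by (auto simp: seq_of_code_def)

text \<open>The set V(U,k,i) of the overview, with \<open>seq_of_code t\<close> as U and the class
  of \<open>i j\<close> modulo \<open>2 ^ j\<close> as the chosen j-th piece.\<close>

definition branch_nbhd :: "nat set \<Rightarrow> nat set \<Rightarrow> (nat \<Rightarrow> nat) \<Rightarrow> nat set" where
  "branch_nbhd t k i = {x. \<forall>j\<le>level x. val k x mod 2 ^ j = i j \<longrightarrow> x \<in> seq_of_code t j}"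

text \<open>Take \<open>N = card I\<close>, which is below \<open>2 ^ N\<close>. Once the pieces
  beyond \<open>N\<close> are avoided, only conditions with \<open>j \<le> N\<close> remain, and
  \<open>seq_of_code t N\<close> satisfies these because the sequence decreases.\<close>

lemma avoid_subset_branch_nbhd:
  assumes "finite X" "X \<subseteq> range (branch_nbhd t k)"
  shows "\<exists>N. \<exists>e\<in>avoids k. e \<inter> seq_of_code t N \<subseteq> \<Inter>X"
proof -
  obtain I where I: "finite I" "X = branch_nbhd t k ` I"
    using assms by (meson finite_subset_image)
  let ?N = "card I"
  have "avoid k ?N I \<in> avoids k"
    using I(1) less_exp[of ?N] unfolding avoids_def by blast
  moreover have "avoid k ?N I \<inter> seq_of_code t ?N \<subseteq> branch_nbhd t k i" if i: "i \<in> I" for i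
  proof
    fix x assume x: "x \<in> avoid k ?N I \<inter> seq_of_code t ?N"
    have "x \<in> seq_of_code t j" if j: "j \<le> level x" "val k x mod 2 ^ j = i j" for j
    proof -
      have "\<not> (?N < j)" using x i j by (auto simp: avoid_def)
      then show ?thesis using x seq_of_code_antimono[of j ?N t] by auto
    qed
    then show "x \<in> branch_nbhd t k i" by (simp add: branch_nbhd_def)
  qed
  ultimately show ?thesis using I(2) by blast
qed

text \<open>\<open>m\<close> is the limit of the level densities along \<open>q\<close>, and
  \<open>indep_family\<close> is applied to its null ideal. The resulting \<open>F\<close>, together
  with all sets of null complement, is extended to \<open>p\<close>.\<close>

lemma ex_ultrafilter_charge:
  obtains p m where "p \<in> topspace omega_star" "charge_mod_finite m"
    "\<And>A. eventually (\<lambda>n. n \<in> A) p \<Longrightarrow> m A \<noteq> 0"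
    "\<And>e::real. 0 < e \<Longrightarrow> \<exists>P. finite P \<and> \<Union>P = UNIV \<and> (\<forall>A\<in>P. m A \<le> ennreal e)"
    "\<And>t. (\<And>n. eventually (\<lambda>x. x \<in> seq_of_code t n) p) \<Longrightarrow>
       \<exists>k. \<forall>i. eventually (\<lambda>x. x \<in> branch_nbhd t k i) p"
proof -
  obtain q :: "nat filter" where q: "ultrafilter q" "q \<le> sequentially"
    using ultrafilter_refines[of sequentially] by auto
  note q_bot = ultrafilter_neq_bot[OF q(1)]
  define \<mu> where "\<mu> A = Lim q (\<lambda>n. density n A)" for A
  define m where "m A = ennreal (\<mu> A)" for A
  have lim: "((\<lambda>n. density n A) \<longlongrightarrow> \<mu> A) q" and nonneg: "0 \<le> \<mu> A" for A
  proof -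
    obtain l where l: "l \<in> {0..1}" "((\<lambda>n. density n A) \<longlongrightarrow> l) q"
      using ultrafilter_tendsto[OF q(1) compact_Icc, of "\<lambda>n. density n A" 0 1]
        density_nonneg density_le_1 by auto
    then have "\<mu> A = l" using tendsto_Lim[OF q_bot l(2)] by (simp add: \<mu>_def)
    then show "((\<lambda>n. density n A) \<longlongrightarrow> \<mu> A) q" "0 \<le> \<mu> A" using l by auto
  qed
  have ev: "eventually P q" if "eventually P sequentially" for P
    using q(2) that by (rule filter_leD)
  have charge: "charge_mod_finite m"
  proof
    have "\<mu> UNIV = 1" using tendsto_unique[OF q_bot lim[of UNIV]] by (simp add: density_UNIV)
    then show "m UNIV = 1" by (simp add: m_def)
  next
    fix A :: "nat set" assume "finite A"
    then have "((\<lambda>n. density n A) \<longlongrightarrow> 0) q"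
      by (intro tendsto_eventually ev density_finite)
    then have "\<mu> A = 0" using tendsto_unique[OF q_bot lim[of A]] by simp
    then show "m A = 0" by (simp add: m_def)
  next
    fix A B :: "nat set" assume "A \<inter> B = {}"
    then have "((\<lambda>n. density n (A \<union> B)) \<longlongrightarrow> \<mu> A + \<mu> B) q"
      by (simp add: density_Un tendsto_add lim)
    then have "\<mu> (A \<union> B) = \<mu> A + \<mu> B" using tendsto_unique[OF q_bot lim[of "A \<union> B"]] by simp
    then show "m (A \<union> B) = m A + m B" by (simp add: m_def nonneg)
  qed
  then interpret charge_mod_finite m .
  have m_pos: "m A \<noteq> 0" if "0 < c" "eventually (\<lambda>n. c \<le> density n A) sequentially" for c A
  proof -
    have "c \<le> \<mu> A" using lim ev[OF that(2)] q_bot by (rule tendsto_lowerbound)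
    then show ?thesis using that(1) by (simp add: m_def)
  qed
  have small: "\<exists>P. finite P \<and> \<Union>P = UNIV \<and> (\<forall>A\<in>P. m A \<le> ennreal e)" if e: "0 < e" for e :: real
  proof -
    have "\<exists>j. (1/2) ^ j < e" using e by (intro real_arch_pow_inv) simp_all
    then obtain j where j: "1 / 2 ^ j < e" unfolding power_one_over by blast
    \<comment> \<open>The residue classes of the single index \<open>{}\<close> already form a fine
      enough partition.\<close>
    let ?A = "\<lambda>r. {x. val {} x mod 2 ^ j = r}"
    have le: "\<mu> (?A r) \<le> 1 / 2 ^ j" for r
      by (rule tendsto_upperbound[OF lim ev q_bot])
        (rule eventually_mono[OF eventually_ge_at_top[of j]], rule density_residue)
    have "m (?A r) \<le> ennreal e" for r
      unfolding m_def by (intro ennreal_leI order_trans[OF le less_imp_le[OF j]])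
    moreover have "\<Union>(?A ` {..<2 ^ j}) = UNIV" by auto
    ultimately show ?thesis by (intro exI[of _ "?A ` {..<2 ^ j}"]) auto
  qed
  let ?J = "{A. m A = 0}"
  have down: "A \<in> ?J" if "A \<subseteq> B" "B \<in> ?J" for A B
    using that m_mono[of A B] by (simp add: Diff_eq_empty_iff[THEN iffD2])
  have ind: "indep ?J avoids {} {}"
    unfolding indep_def
  proof (intro allI impI)
    fix X S e
    assume "X \<subseteq> ({} :: nat set set)" "finite S" "\<forall>k\<in>S. e k \<in> avoids k"
    then obtain c where "0 < c" "eventually (\<lambda>n. c \<le> density n (\<Inter>k\<in>S. e k)) sequentially"
      using density_avoids[of S e] by auto
    then show "\<Inter>X \<inter> (\<Inter>k\<in>S. e k) \<notin> ?J"
      using m_pos \<open>X \<subseteq> {}\<close> by auto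
  qed
  have inf: "infinite (UNIV :: nat set set)"
    using finite_Pow_iff[of "UNIV :: nat set"] infinite_UNIV_nat by simp
  have "\<exists>F. (\<forall>X. finite X \<longrightarrow> X \<subseteq> F \<longrightarrow> \<Inter>X \<notin> ?J) \<and> (\<forall>t. (\<exists>k. range (branch_nbhd t k) \<subseteq> F) \<or>
      (\<exists>X N. finite X \<and> X \<subseteq> F \<and> \<Inter>X \<inter> seq_of_code t N \<in> ?J))"
    by (rule indep_family[where V = "\<lambda>t k. range (branch_nbhd t k)" and U = seq_of_code,
          OF inf down avoid_subset_branch_nbhd ind])
  then obtain F where F: "\<And>X. finite X \<Longrightarrow> X \<subseteq> F \<Longrightarrow> \<Inter>X \<notin> ?J"
    "\<And>t. (\<exists>k. range (branch_nbhd t k) \<subseteq> F) \<or>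
      (\<exists>X N. finite X \<and> X \<subseteq> F \<and> \<Inter>X \<inter> seq_of_code t N \<in> ?J)"
    by metis
  \<comment> \<open>Adding the co-null sets keeps every null set out of \<open>p\<close>; as finite
    sets are null, \<open>p\<close> is also nonprincipal.\<close>
  let ?N = "{A. m (- A) = 0}"
  have fip: "\<Inter>X \<noteq> {}" if X: "finite X" "X \<subseteq> F \<union> ?N" for X
  proof
    assume "\<Inter>X = {}"
    then have sub: "\<Inter>(X \<inter> F) \<subseteq> (\<Union>A\<in>X \<inter> ?N. - A)" using X(2) by blast
    have "finite (X \<inter> ?N)" using X(1) by simp
    then have "m (\<Union>A\<in>X \<inter> ?N. - A) = 0"
    proof (rule finite_subset_induct[where A = ?N])
      fix A Y assume "A \<in> ?N" "m (\<Union>A\<in>Y. - A) = 0"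
      then show "m (\<Union>A\<in>insert A Y. - A) = 0"
        using m_subadd[of "- A" "\<Union>A\<in>Y. - A"] by simp
    qed (auto simp: m_finite)
    then have "\<Inter>(X \<inter> F) \<in> ?J" using down[OF sub] by simp
    then show False using F(1)[of "X \<inter> F"] X(1) by simp
  qed
  obtain p where p: "ultrafilter p" "\<And>A. A \<in> F \<union> ?N \<Longrightarrow> eventually (\<lambda>x. x \<in> A) p"
    using fip by (rule ultrafilter_FIP[of "F \<union> ?N"]) blast+
  have pos: "m A \<noteq> 0" if "eventually (\<lambda>x. x \<in> A) p" for A
  proof
    assume "m A = 0"
    then have "eventually (\<lambda>x. x \<in> - A) p" by (intro p(2)) simp
    then show False using that p(1) by (simp add: ultrafilter_not_eventually)
  qed
  have "eventually (\<lambda>x. x \<in> {k..}) p" for k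
  proof (rule p(2))
    have "- {k..} = {..<k}" by auto
    then show "{k..} \<in> F \<union> ?N" by (simp add: m_finite)
  qed
  then have top: "p \<in> topspace omega_star"
    using p(1) by (auto simp: mem_topspace_omega_star intro: le_sequentiallyI)
  have branch: "\<exists>k. \<forall>i. eventually (\<lambda>x. x \<in> branch_nbhd t k i) p"
    if t: "\<And>n. eventually (\<lambda>x. x \<in> seq_of_code t n) p" for t
  proof -
    \<comment> \<open>The second alternative of \<open>F(2)\<close> would put a null set into
      \<open>p\<close>.\<close>
    have "\<Inter>X \<inter> seq_of_code t N \<notin> ?J" if "finite X" "X \<subseteq> F" for X N
    proof -
      have "eventually (\<lambda>x. \<forall>A\<in>X. x \<in> A) p"
        using that by (intro eventually_ball_finite ballI p(2)) auto
      then have "eventually (\<lambda>x. x \<in> \<Inter>X \<inter> seq_of_code t N) p"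
        using t[of N] by eventually_elim auto
      then show ?thesis using pos by simp
    qed
    then obtain k where "range (branch_nbhd t k) \<subseteq> F" using F(2)[of t] by blast
    then show ?thesis using p(2) by blast
  qed
  show ?thesis using that[OF top charge pos small branch] by blast
qed

lemma weak_P_pointI:
  assumes p: "p \<in> topspace omega_star"
    and branch: "\<And>t. (\<And>n. eventually (\<lambda>x. x \<in> seq_of_code t n) p) \<Longrightarrow>
       \<exists>k. \<forall>i. eventually (\<lambda>x. x \<in> branch_nbhd t k i) p"
  shows "weak_P_point omega_star p"
  unfolding weak_P_point_def
proof (intro conjI allI impI p)
  fix C assume C: "countable C \<and> C \<subseteq> topspace omega_star - {p}"
  show "p \<notin> omega_star closure_of C"
  proof (cases "C = {}")
    case False
    then obtain d :: "nat \<Rightarrow> nat filter" where d: "range d = C"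
      using C by (metis uncountable_def)
    have dt: "d j \<in> topspace omega_star" "d j \<noteq> p" for j using C d by auto
    have uf: "ultrafilter p" "ultrafilter (d j)" "d j \<le> sequentially" for j
      using p dt(1) by (auto simp: mem_topspace_omega_star)
    have "\<exists>A. eventually (\<lambda>x. x \<in> A) p \<and> \<not> eventually (\<lambda>x. x \<in> A) (d j)" for j
      using ultrafilter_neqE[OF uf(1,2) dt(2)[symmetric]] by blast
    then obtain A where A: "\<And>j. eventually (\<lambda>x. x \<in> A j) p"
      "\<And>j. \<not> eventually (\<lambda>x. x \<in> A j) (d j)" by metis
    obtain t where t: "\<And>n. seq_of_code t n = (\<Inter>i\<le>n. A i)" using seq_of_code_surj by metis
    have "eventually (\<lambda>x. x \<in> seq_of_code t n) p" for n
    proof -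
      have "eventually (\<lambda>x. \<forall>i\<in>{..n}. x \<in> A i) p" by (intro eventually_ball_finite ballI A(1)) simp
      then show ?thesis by (simp add: t)
    qed
    \<comment> \<open>The order of quantifiers matters: \<open>k\<close> works for all
      \<open>i\<close>, so \<open>i\<close> may be read off afterwards from \<open>k\<close> and the
      \<open>d j\<close>.\<close>
    then obtain k where k: "\<And>i. eventually (\<lambda>x. x \<in> branch_nbhd t k i) p" using branch by blast
    have "\<exists>r. eventually (\<lambda>x. val k x mod 2 ^ j = r) (d j)" for j
    proof -
      have "eventually (\<lambda>x. \<exists>r\<in>{..<2 ^ j}. val k x mod 2 ^ j = r) (d j)" by simp
      then show ?thesis by (subst (asm) ultrafilter_eventually_bex[OF uf(2)]) auto
    qed
    \<comment> \<open>The classes modulo \<open>2 ^ j\<close> form a finite partition, so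
      \<open>d j\<close> contains one of them.\<close>
    then obtain i where i: "\<And>j. eventually (\<lambda>x. val k x mod 2 ^ j = i j) (d j)" by metis
    have "\<not> eventually (\<lambda>x. x \<in> branch_nbhd t k i) (d j)" for j
    proof
      assume "eventually (\<lambda>x. x \<in> branch_nbhd t k i) (d j)"
      \<comment> \<open>Levels are finite and \<open>d j\<close> is nonprincipal, so the condition
        at \<open>j\<close> in \<open>branch_nbhd\<close> is active along \<open>d j\<close> and
        would put \<open>A j\<close> into it.\<close>
      moreover have "eventually (\<lambda>x. j \<le> level x) (d j)"
      proof (rule filter_leD[OF uf(3)])
        have "finite (\<Union>n\<in>{..<j}. {x. level x = n})" using finite_block by blast
        then obtain N where "\<forall>x\<in>(\<Union>n\<in>{..<j}. {x. level x = n}). x < N"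
          by (meson finite_nat_set_iff_bounded)
        then have "\<forall>x\<ge>N. j \<le> level x" by (auto simp: not_less[symmetric])
        then show "eventually (\<lambda>x. j \<le> level x) sequentially" by (auto simp: eventually_sequentially)
      qed
      ultimately have "eventually (\<lambda>x. x \<in> A j) (d j)" using i[of j]
        by eventually_elim (auto simp: branch_nbhd_def t)
      then show False using A(2) by blast
    qed
    then have "hat (branch_nbhd t k i) \<inter> C = {}" using d by (auto simp: hat_def)
    moreover have "p \<in> hat (branch_nbhd t k i)" using p k by (simp add: hat_def)
    ultimately show ?thesis using openin_hat by (auto simp: in_closure_of)
  qed simp
qed

theorem theorem5p7:
  shows "\<exists>p \<in> topspace omega_star. weak_P_point omega_star p \<and> \<not> mu_point omega_star p"
proof -
  obtain p m where p: "p \<in> topspace omega_star" and m: "charge_mod_finite m"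
    and pos: "\<And>A. eventually (\<lambda>n. n \<in> A) p \<Longrightarrow> m A \<noteq> 0"
    and small: "\<And>e::real. 0 < e \<Longrightarrow> \<exists>P. finite P \<and> \<Union>P = UNIV \<and> (\<forall>A\<in>P. m A \<le> ennreal e)"
    and branch: "\<And>t. (\<And>n. eventually (\<lambda>x. x \<in> seq_of_code t n) p) \<Longrightarrow>
       \<exists>k. \<forall>i. eventually (\<lambda>x. x \<in> branch_nbhd t k i) p"
    by (rule ex_ultrafilter_charge) blast
  interpret charge_mod_finite m by (rule m)
  have "p \<in> measure_support omega_star extension"
    using p pos by (rule mem_measure_support_extension)
  moreover have "nonatomic extension" using small by (rule nonatomic_extension)
  ultimately have "\<not> mu_point omega_star p"
    using radon_extension by (auto simp: mu_point_def)
  moreover have "weak_P_point omega_star p" using p branch by (rule weak_P_pointI)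
  ultimately show ?thesis using p by blast
qed

end
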